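(* Let $\mu_1,\ldots,\mu_{d-k+2}$ be mass assignments on $Hor_k^{k-1}(\mathbb{R}^d)$, where $2\leq k\leq d$. Then there exists a $k$-dimensional $(k-1)$-horizontal linear subspace $h$ of $\mathbb{R}^d$ where $\mu_1^h,\ldots,\mu_{d-k+2}^h$ have a common Ham-Sandwich cut; that is, there is a hyperplane of $h$ (a $(k-1)$-dimensional affine subspace of $h$) that simultaneously bisects $\mu_1^h,\ldots,\mu_{d-k+2}^h$.
   Context: A ($k$-dimensional) mass distribution $\mu$ on a $k$-dimensional real Euclidean space $h$ (for instance a $k$-dimensional linear subspace of $\mathbb{R}^d$) is a measure on $h$ such that all open subsets of $h$ are measurable, $0<\mu(h)<\infty$, and $\mu(S)=0$ for every lower-dimensional subset $S$ of $h$. A hyperplane of $h$ bisects $\mu$ if each of the two halfspaces of $h$ bounded by it contains exactly half of the total mass $\mu(h)$. $M_k$ denotes the space of all $k$-dimensional mass distributions. Let $e_i$ denote the $i$-th unit vector of $\mathbb{R}^d$. A linear subspace of $\mathbb{R}^d$ is called $m$-horizontal if it contains $e_1,\ldots,e_m$. $Hor_k^m(\mathbb{R}^d)$ denotes the space of all $m$-horizontal, $k$-dimensional linear subspaces of $\mathbb{R}^d$; it is a subspace of the Grassmann manifold $G_k(\mathbb{R}^d)$ of all $k$-dimensional linear subspaces of $\mathbb{R}^d$. A mass assignment on $Hor_k^m(\mathbb{R}^d)$ is a continuous assignment $\mu: Hor_k^m(\mathbb{R}^d)\rightarrow M_k$; that is, $\mu$ continuously assigns a $k$-dimensional mass distribution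 $\mu^h:=\mu(h)$ on $h$ to each $h\in Hor_k^m(\mathbb{R}^d)$. *)

theory Defs
  imports "HOL-Analysis.Analysis"
begin

section \<open>Mass distributions\<close>

text \<open>A measure on a subspace \<open>h\<close> of the ambient space is a measure whose carrier is \<open>h\<close>. Its
  sigma-algebra contains the relatively open subsets of \<open>h\<close>, but may be larger than the Borel one.
  ``Lower-dimensional'' refers to the affine dimension: the null sets demanded here are the
  measurable sets lying in a proper affine subspace of \<open>h\<close>. This is the weakest reading, since
  such sets are lower-dimensional for any notion of dimension.\<close>

definition mass_distribution :: "'a::euclidean_space set \<Rightarrow> 'a measure \<Rightarrow> bool" where
  "mass_distribution h M \<longleftrightarrow>
     space M = h \<and>
     (\<forall>U. openin (top_of_set h) U \<longrightarrow> U \<in> sets M) \<and>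
     0 < emeasure M h \<and> emeasure M h < \<infinity> \<and>
     (\<forall>S\<in>sets M. aff_dim S < aff_dim h \<longrightarrow> emeasure M S = 0)"

definition mass_distributions :: "nat \<Rightarrow> 'a::euclidean_space measure set" where
  "mass_distributions k = {M. \<exists>h. subspace h \<and> dim h = k \<and> mass_distribution h M}"

text \<open>The weak topology: the coarsest one making \<open>M \<mapsto> \<integral> f dM\<close> continuous for every bounded
  continuous \<open>f\<close>. Test functions live on the ambient space so that masses on different subspaces
  can be compared; on a single subspace nothing is lost, because every bounded continuous function
  on it extends to the ambient space via the orthogonal projection.\<close>

definition mass_space :: "nat \<Rightarrow> 'a::euclidean_space measure topology" where
  "mass_space k =
     pullback_topology (mass_distributions k)
       (\<lambda>M. \<lambda>f :: 'a \<Rightarrow>\<^sub>C real. \<integral>x. apply_bcontfun f x \<partial>M)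
       (product_topology (\<lambda>_. euclideanreal) UNIV)"

lemma topspace_mass_space [simp]: "topspace (mass_space k) = mass_distributions k"
  by (simp add: mass_space_def topspace_pullback_topology)


section \<open>Spaces of linear subspaces\<close>

text \<open>The usual topology of the Grassmann manifold, via its standard embedding that sends a
  subspace to the matrix of the orthogonal projection onto it (for a subspace \<open>h\<close>, the map
  \<open>closest_point h\<close> is this projection).\<close>

definition grassmannian :: "nat \<Rightarrow> (real ^ 'd) set topology" where
  "grassmannian k =
     pullback_topology {h. subspace h \<and> dim h = k} (\<lambda>h. matrix (closest_point h)) euclidean"

lemma topspace_grassmannian [simp]: "topspace (grassmannian k) = {h. subspace h \<and> dim h = k}"
  by (simp add: grassmannian_def topspace_pullback_topology)

text \<open>The coordinates, indexed by \<open>'d\<close>, are numbered \<open>1, \<dots>, CARD('d)\<close> in increasing order.\<close>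

definition unit_vec :: "nat \<Rightarrow> real ^ 'd::{finite,linorder}" where
  "unit_vec i = axis (sorted_list_of_set UNIV ! (i - 1)) 1"

definition horizontal :: "nat \<Rightarrow> (real ^ 'd::{finite,linorder}) set \<Rightarrow> bool" where
  "horizontal m h \<longleftrightarrow> (\<forall>i\<in>{1..m}. unit_vec i \<in> h)"

definition Hor :: "nat \<Rightarrow> nat \<Rightarrow> (real ^ 'd::{finite,linorder}) set topology" where
  "Hor m k = subtopology (grassmannian k) {h. horizontal m h}"

lemma topspace_Hor:
  "topspace (Hor m k) = {h. subspace h \<and> dim h = k \<and> horizontal m h}"
  by (auto simp: Hor_def)

definition mass_assignment ::
    "nat \<Rightarrow> nat \<Rightarrow> ((real ^ 'd::{finite,linorder}) set \<Rightarrow>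
      (real ^ 'd::{finite,linorder}) measure) \<Rightarrow> bool" where
  "mass_assignment m k \<mu> \<longleftrightarrow>
     continuous_map (Hor m k) (mass_space k) \<mu> \<and>
     (\<forall>h\<in>topspace (Hor m k). mass_distribution h (\<mu> h))"


section \<open>Bisecting hyperplanes\<close>

definition hyperplane_of :: "'a::euclidean_space set \<Rightarrow> 'a set \<Rightarrow> bool" where
  "hyperplane_of h H \<longleftrightarrow> affine H \<and> H \<subseteq> h \<and> aff_dim H = aff_dim h - 1"

text \<open>A hyperplane \<open>H\<close> of a linear subspace \<open>h\<close> has a normal vector \<open>a\<close> in \<open>h\<close>, and the two
  halfspaces of \<open>h\<close> it bounds do not depend on the choice of \<open>a\<close>.\<close>

definition bisects :: "'a::euclidean_space set \<Rightarrow> 'a set \<Rightarrow> 'a measure \<Rightarrow> bool" where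
  "bisects h H M \<longleftrightarrow>
     (\<exists>a\<in>h. \<exists>b. a \<noteq> 0 \<and> H = {x\<in>h. a \<bullet> x = b} \<and>
        measure M {x\<in>h. a \<bullet> x \<le> b} = measure M h / 2 \<and>
        measure M {x\<in>h. a \<bullet> x \<ge> b} = measure M h / 2)"

end

theory Submission
  imports Defs "HOL-Homology.Homology"
begin

text \<open>A horizontal subspace is \<open>h v = span {e\<^sub>1, \<dots>, e\<^sub>k\<^sub>-\<^sub>1, v}\<close> with \<open>v\<close> in the unit sphere of dimension
  \<open>n = d - k\<close>, and it suffices to consider hyperplanes of \<open>h v\<close> with normal \<open>(1 - t) v + t e\<^sub>1\<close>, where
  \<open>0 \<le> t \<le> 1\<close>. Choosing the hyperplane that bisects the first mass, the imbalances of the other \<open>n + 1\<close>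
  masses are functions of \<open>(t, v)\<close> that are odd in \<open>v\<close> at \<open>t = 0\<close> and even in \<open>v\<close> at \<open>t = 1\<close>. If they had
  no common zero, normalising them would give a homotopy between an odd and an even self-map of the
  sphere, but these have odd and even degree respectively.

  Medians are not unique, so the sign of \<open>u \<bullet> x - b\<close> is first replaced by the strictly increasing
  \<open>(2 / \<pi>) arctan (N (u \<bullet> x - b))\<close>. This makes the median unique and everything weakly continuous; the
  theorem follows by compactness as \<open>N\<close> tends to infinity, because hyperplanes have mass zero.\<close>

section \<open>Odd and even maps of spheres\<close>

text \<open>With n = d - k the parameters (t, v) range over [0,1] x S^n, whose dimension n + 1 is
  the number of equations left once the offset has been spent on the first mass. The vector
  \<open>unit_vec 1\<close> is a fixed direction in every horizontal subspace because k \<ge> 2.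

  Parity of degrees is handled on integral chains, modulo twice a cycle: an odd map sends the
  fundamental cycle z to z + 2x and an even map sends it to 2y, up to homology, so a homotopy would
  make z divisible by 2. The obstacle is to exclude this; it is done by descending through the
  equators to S^0, where it becomes the parity of an integer. Reduced homology lets n = 0, the case
  k = d, run along with the others.

  In the limit two things could go wrong: the offsets could escape to infinity, and weak convergence
  says nothing directly about soft signs whose slopes are unbounded. Both are settled by comparison
  with continuous ramps of fixed slope, from one side only; the reversal of (u, b) to (-u, -b)
  supplies the opposite inequalities.\<close>

definition antipode :: "(nat \<Rightarrow> real) \<Rightarrow> nat \<Rightarrow> real" where
  "antipode x = (\<lambda>i. - x i)"

lemma antipode_antipode [simp]: "antipode (antipode x) = x"
  by (simp add: antipode_def)

lemma continuous_map_antipode: "continuous_map (nsphere n) (nsphere n) antipode"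
proof -
  have "continuous_map (nsphere n) (powertop_real UNIV) antipode"
    unfolding antipode_def continuous_map_componentwise_UNIV
    by (intro allI continuous_map_minus continuous_map_nsphere_projection)
  moreover have "antipode \<in> topspace (nsphere n) \<rightarrow> {x. (\<Sum>i\<le>n. (x i)\<^sup>2) = 1 \<and> (\<forall>i>n. x i = 0)}"
    by (simp add: nsphere antipode_def)
  ultimately show ?thesis
    by (subst (2) nsphere) (simp add: continuous_map_in_subtopology image_subset_iff_funcset)
qed

text \<open>Being a boundary over the one-point space is the kernel condition of reduced homology,
  stated on chains. It restricts only degree 0, where it says that the coefficients sum to
  zero.\<close>

definition reduced_cycle :: "nat \<Rightarrow> 'a topology \<Rightarrow> 'a chain \<Rightarrow> bool" where
  "reduced_cycle p X c \<longleftrightarrow> singular_relcycle p X {} c \<and>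
     singular_relboundary p (discrete_topology {()}) {} (chain_map p (\<lambda>x. ()) c)"

lemma reduced_cycle_Suc:
  assumes "singular_relcycle (Suc p) X {} c"
  shows "reduced_cycle (Suc p) X c"
proof -
  have "singular_relcycle (Suc p) (discrete_topology {()}) {} (chain_map (Suc p) (\<lambda>x. ()) c)"
    by (rule singular_relcycle_chain_map [OF assms]) auto
  then show ?thesis
    unfolding reduced_cycle_def using assms
    by (subst singular_boundary_eq_cycle_singleton) auto
qed

lemma reduced_cycle_imp_carrier:
  assumes "reduced_cycle p X c"
  shows "homologous_rel_set p X {} c \<in> carrier (reduced_homology_group (int p) X)"
proof -
  have "hom_induced (int p) X {} (discrete_topology {()}) {} (\<lambda>x. ()) (homologous_rel_set p X {} c)
      = \<one>\<^bsub>homology_group (int p) (discrete_topology {()})\<^esub>"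
    using assms unfolding reduced_cycle_def
    by (simp add: hom_induced_chain_map homologous_rel_set_eq_relboundary)
  with assms show ?thesis
    by (simp add: carrier_reduced_homology_group kernel_def carrier_relative_homology_group reduced_cycle_def)
qed

lemma reduced_cycle_imp_boundary:
  assumes "trivial_group (reduced_homology_group (int p) X)" "reduced_cycle p X c"
  shows "singular_relboundary p X {} c"
proof -
  have "homologous_rel_set p X {} c = \<one>\<^bsub>reduced_homology_group (int p) X\<^esub>"
    using reduced_cycle_imp_carrier [OF assms(2)] assms(1) by (simp add: trivial_group_def)
  then show ?thesis
    by (simp add: one_reduced_homology_group homologous_rel_set_eq_relboundary)
qed

lemma reduced_cycle_subtopology:
  assumes "reduced_cycle p (subtopology X S) c" "S \<subseteq> T"
  shows "reduced_cycle p (subtopology X T) c"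
  using assms singular_cycle_mono unfolding reduced_cycle_def by blast

text \<open>The sign makes \<open>antipodal_sum n c\<close> a cycle whenever the boundary of \<open>c\<close> is
  \<open>antipodal_sum (n - 1) b\<close> for some \<open>b\<close>.\<close>

abbreviation antipodal_sum :: "nat \<Rightarrow> (nat \<Rightarrow> real) chain \<Rightarrow> (nat \<Rightarrow> real) chain" where
  "antipodal_sum n c \<equiv> c + frag_cmul ((-1) ^ Suc n) (chain_map n antipode c)"

lemma chain_map_antipode_antipode:
  assumes "singular_chain p (nsphere n) c"
  shows "chain_map p antipode (chain_map p antipode c) = c"
proof -
  have "chain_map p antipode (chain_map p antipode c) = chain_map p (antipode \<circ> antipode) c"
    by (simp add: chain_map_compose)
  also have "\<dots> = c"
    by (rule chain_map_id_gen [OF assms]) simp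
  finally show ?thesis .
qed

text \<open>With A the antipodal chain map and s the sign, this is (1 - s A)(1 + s A) = 1 - A^2 =
  0.\<close>

lemma antipodal_sum_antipodal_sum:
  assumes "singular_chain p (nsphere n) c"
  shows "antipodal_sum p c + frag_cmul ((-1) ^ p) (chain_map p antipode (antipodal_sum p c)) = 0"
  by (simp add: chain_map_antipode_antipode [OF assms] chain_map_add frag_cmul_distrib2 flip: power_add frag_cmul_distrib)

lemma chain_boundary_antipodal_sum:
  assumes c: "singular_chain (Suc p) (nsphere n) c" and b: "singular_chain p (nsphere n) b"
    and "chain_boundary (Suc p) c = antipodal_sum p b"
  shows "chain_boundary (Suc p) (antipodal_sum (Suc p) c) = 0"
  using antipodal_sum_antipodal_sum [OF b] assms
  by (simp add: chain_boundary_add chain_boundary_cmul chain_boundary_chain_map [OF c])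

text \<open>\<open>c n\<close> fills the upper hemisphere of the \<open>n\<close>-sphere, and \<open>antipodal_sum n (c n)\<close> is a fundamental
  cycle of that sphere; it bounds the next hemisphere.\<close>

definition sphere_chain :: "(nat \<Rightarrow> (nat \<Rightarrow> real) chain) \<Rightarrow> bool" where
  "sphere_chain c \<longleftrightarrow> c 0 = frag_of (restrict (\<lambda>_ n. if n = 0 then 1 else 0) (standard_simplex 0)) \<and>
    (\<forall>n. singular_chain n (subtopology (nsphere n) {x. 0 \<le> x n}) (c n)) \<and>
    (\<forall>n. chain_boundary (Suc n) (c (Suc n)) = antipodal_sum n (c n))"

lemma nsphere_eq_subtopology_hemisphere:
  "nsphere n = subtopology (subtopology (nsphere (Suc n)) {x. 0 \<le> x (Suc n)}) {x. x (Suc n) = 0}"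
proof -
  have "{x. 0 \<le> x (Suc n)} \<inter> {x. x (Suc n) = 0} = {x. x (Suc n) = (0::real)}"
    by auto
  then show ?thesis
    by (simp add: subtopology_nsphere_equator subtopology_subtopology)
qed

lemma singular_chain_nsphere_mono:
  assumes "singular_chain p (nsphere n) c" "n \<le> m"
  shows "singular_chain p (nsphere m) c"
  using assms(2,1)
proof (induction rule: dec_induct)
  case (step m)
  then show ?case
    by (metis subtopology_nsphere_equator singular_chain_subtopology)
qed

lemma singular_cycle_antipodal_sum:
  assumes "singular_chain p (nsphere n) c" "chain_boundary p (antipodal_sum p c) = 0"
  shows "singular_relcycle p (nsphere n) {} (antipodal_sum p c)"
  using assms unfolding singular_cycle
  by (auto intro!: singular_chain_add singular_chain_cmul singular_chain_chain_map continuous_map_antipode)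

lemma reduced_cycle_0_diff:
  assumes "singular_chain 0 X a" "singular_chain 0 X b" "chain_map 0 (\<lambda>x. ()) a = chain_map 0 (\<lambda>x. ()) b"
  shows "reduced_cycle 0 X (a - b)"
  using assms unfolding reduced_cycle_def
  by (simp add: singular_cycle singular_chain_diff chain_boundary_def chain_map_diff)

text \<open>Hemispheres are contractible, so the reduced cycle \<open>antipodal_sum n c\<close> on
  the equator bounds in the next one. Reducedness belongs to the induction invariant
  \<open>?P\<close> for the sake of the step out of degree 0.\<close>

lemma sphere_chain_exists: "\<exists>c. sphere_chain c"
proof -
  define a :: "(nat \<Rightarrow> real) chain" where "a = frag_of (restrict (\<lambda>_ n. if n = 0 then 1 else 0) (standard_simplex 0))"
  let ?U = "\<lambda>n. subtopology (nsphere n) {x. 0 \<le> x n}"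
  let ?P = "\<lambda>n c. (n = 0 \<longrightarrow> c = a) \<and> singular_chain n (?U n) c \<and> reduced_cycle n (nsphere n) (antipodal_sum n c)"
  let ?Q = "\<lambda>n c c'. chain_boundary (Suc n) c' = antipodal_sum n c"
  have "\<exists>f. \<forall>n. ?P n (f n) \<and> ?Q n (f n) (f (Suc n))"
  proof (rule dependent_nat_choice [of ?P ?Q])
    have 1: "singular_chain 0 (?U 0) a"
      using in_topspace_nsphere [of 0]
      by (auto simp: a_def singular_chain_of singular_simplex_def continuous_map_in_subtopology)
    then have 2: "singular_chain 0 (nsphere 0) a"
      by (simp add: singular_chain_subtopology)
    \<comment> \<open>In degree 0 the sign is -1, so the antipodal sum is a difference of two
      points, and these have the same image over the one-point space.\<close>
    have 3: "chain_map 0 (\<lambda>x. ()) (chain_map 0 antipode a) = chain_map 0 (\<lambda>x. ()) a"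
      by (simp add: a_def chain_map_of simplex_map_def restrict_def)
    have "reduced_cycle 0 (nsphere 0) (antipodal_sum 0 a)"
      using reduced_cycle_0_diff [OF 2 singular_chain_chain_map [OF 2 continuous_map_antipode]] 3
      by simp
    with 1 show "\<exists>c. ?P 0 c" by blast
  next
    fix c n assume P: "?P n c"
    then have c: "singular_chain n (nsphere n) c"
      by (simp add: singular_chain_subtopology)
    have "{x. x (Suc n) = (0::real)} \<subseteq> {x. 0 \<le> x (Suc n)}" by auto
    then have "reduced_cycle n (?U (Suc n)) (antipodal_sum n c)"
      using P reduced_cycle_subtopology [of n "nsphere (Suc n)" "{x. x (Suc n) = 0}"]
      by (simp only: subtopology_nsphere_equator)
    then have "singular_relboundary n (?U (Suc n)) {} (antipodal_sum n c)"
      by (rule reduced_cycle_imp_boundary [rotated])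
         (intro trivial_reduced_homology_group_contractible_space contractible_space_upper_hemisphere, simp)
    then obtain d where d: "singular_chain (Suc n) (?U (Suc n)) d" "chain_boundary (Suc n) d = antipodal_sum n c"
      using singular_boundary by blast
    then have d': "singular_chain (Suc n) (nsphere (Suc n)) d"
      by (simp add: singular_chain_subtopology)
    have "singular_relcycle (Suc n) (nsphere (Suc n)) {} (antipodal_sum (Suc n) d)"
      using singular_cycle_antipodal_sum [OF d']
        chain_boundary_antipodal_sum [OF d' singular_chain_nsphere_mono [OF c] d(2)]
      by simp
    then show "\<exists>c'. ?P (Suc n) c' \<and> ?Q n c c'"
      using d reduced_cycle_Suc by blast
  qed
  then show ?thesis
    unfolding sphere_chain_def a_def by metis
qed

section \<open>Divisibility by two and the fundamental cycle\<close>

lemma homologous_rel_empty_imp: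
  assumes "homologous_rel p X {} a b"
  shows "homologous_rel p X S a b"
proof -
  obtain d where "singular_chain (Suc p) X d" "chain_boundary (Suc p) d = a - b + 0"
    using assms by (auto simp: homologous_rel_def singular_boundary)
  then show ?thesis
    unfolding homologous_rel_def singular_relboundary_alt using singular_chain_0 by blast
qed

lemma frag_cmul_diff: "frag_cmul k (a - b) = frag_cmul k a - frag_cmul k b"
  by (metis add_diff_cancel diff_add_cancel frag_cmul_distrib2)

lemma homologous_rel_cmul:
  assumes "homologous_rel p X S a b"
  shows "homologous_rel p X S (frag_cmul k a) (frag_cmul k b)"
  using singular_relboundary_cmul [of p X S "a - b" k] assms unfolding homologous_rel_def
  by (simp add: frag_cmul_diff)

lemma homologous_rel_set_mult:
  "homologous_rel_set p X S a \<otimes>\<^bsub>relative_homology_group (int p) X S\<^esub> homologous_rel_set p X S b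
    = homologous_rel_set p X S (a + b)"
proof -
  have "\<exists>r s. homologous_rel p X S a r \<and> homologous_rel p X S b s \<and> x = r + s"
    if "homologous_rel p X S (a + b) x" for x
  proof (intro exI conjI)
    show "homologous_rel p X S a a" "x = a + (x - a)" by auto
    show "homologous_rel p X S b (x - a)"
      using homologous_rel_diff [OF that homologous_rel_refl [of p X S a]] by simp
  qed
  then show ?thesis
    by (auto simp: mult_relative_homology_group homologous_rel_add)
qed

text \<open>The degree is multiplicative and the antipode is an involution, so its degree squares to
  1 and is a sign. The value of the sign does not matter for parity.\<close>

lemma antipode_reduced_cycle:
  assumes "reduced_cycle n (nsphere n) w"
  shows "homologous_rel n (nsphere n) {} (chain_map n antipode w) w \<or>
         homologous_rel n (nsphere n) {} (chain_map n antipode w) (- w)"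
proof -
  let ?G = "reduced_homology_group (int n) (nsphere n)"
  let ?d = "Brouwer_degree2 n antipode"
  let ?W = "homologous_rel_set n (nsphere n) {} w"
  interpret group ?G by simp
  have "?d * ?d = Brouwer_degree2 n (antipode \<circ> antipode)"
    by (simp add: Brouwer_degree2_compose continuous_map_antipode)
  also have "\<dots> = Brouwer_degree2 n id"
    by (rule Brouwer_degree2_eq) simp
  finally have "?d = 1 \<or> ?d = -1"
    by (simp add: zmult_eq_1_iff)
  have W: "?W \<in> carrier ?G"
    by (rule reduced_cycle_imp_carrier [OF assms])
  have w: "singular_relcycle n (nsphere n) {} w"
    using assms reduced_cycle_def by blast
  have eq: "homologous_rel_set n (nsphere n) {} (chain_map n antipode w) = ?W [^]\<^bsub>?G\<^esub> ?d"
    using Brouwer_degree2 [OF W, of antipode] w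
    by (simp add: hom_induced_chain_map continuous_map_antipode)
  from \<open>?d = 1 \<or> ?d = -1\<close> show ?thesis
  proof
    assume "?d = 1"
    then show ?thesis
      using eq W by (simp add: int_pow_1 homologous_rel_set_eq)
  next
    assume "?d = -1"
    then have "homologous_rel_set n (nsphere n) {} (chain_map n antipode w) \<otimes>\<^bsub>?G\<^esub> ?W = \<one>\<^bsub>?G\<^esub>"
      using eq W by (simp add: int_pow_neg int_pow_1)
    then have "homologous_rel_set n (nsphere n) {} (chain_map n antipode w + w)
      = singular_relboundary_set n (nsphere n) {}"
      using homologous_rel_set_mult [of n "nsphere n" "{}"]
      by (simp add: reduced_homology_group_def)
    then have "singular_relboundary n (nsphere n) {} (chain_map n antipode w + w)"
      by (simp only: homologous_rel_set_eq_relboundary)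
    then show ?thesis
      by (simp add: homologous_rel_def)
  qed
qed

text \<open>The antipode acts on the class of \<open>w\<close> by a sign, so up to homology the sum
  is w + w or w - w, and \<open>u\<close> is \<open>w\<close> or 0.\<close>

lemma antipodal_sum_even_class:
  assumes "reduced_cycle n (nsphere n) w"
  shows "\<exists>u. singular_relcycle n (nsphere n) {} u \<and>
             homologous_rel n (nsphere n) {} (antipodal_sum n w) (frag_cmul 2 u)"
proof -
  let ?h = "homologous_rel n (nsphere n) {}"
  have w: "singular_relcycle n (nsphere n) {} w"
    using assms reduced_cycle_def by blast
  obtain s :: int where s: "s = 1 \<or> s = -1" "?h (chain_map n antipode w) (frag_cmul s w)"
    using antipode_reduced_cycle [OF assms] by (metis frag_cmul_minus_one frag_cmul_one)
  have "?h (antipodal_sum n w) (w + frag_cmul ((-1) ^ Suc n) (frag_cmul s w))"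
    by (intro homologous_rel_add homologous_rel_refl homologous_rel_cmul s)
  moreover have "w + frag_cmul ((-1) ^ Suc n) (frag_cmul s w) \<in> {frag_cmul 2 0, frag_cmul 2 w}"
    using s(1) frag_cmul_distrib [of 1 1 w] by (cases "even n") auto
  ultimately show ?thesis
    using w singular_relcycle_0 by (metis empty_iff insert_iff)
qed

text \<open>Surjectivity of the excision isomorphism from the upper hemisphere modulo its equator to
  the sphere modulo the lower hemisphere, read on representing chains.\<close>

lemma hemisphere_relcycle:
  assumes "singular_relcycle p (nsphere n) {x. x k \<le> 0} x"
  obtains y where "singular_relcycle p (subtopology (nsphere n) {x. 0 \<le> x k}) {x. x k = 0} y"
    "homologous_rel p (nsphere n) {x. x k \<le> 0} x y"
proof -
  let ?U = "subtopology (nsphere n) {x. 0 \<le> x k}" and ?E = "{x. x k = (0::real)}"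
  let ?D = "{x. x k \<le> (0::real)}"
  have "homologous_rel_set p (nsphere n) ?D x \<in> carrier (relative_homology_group (int p) (nsphere n) ?D)"
    using assms by (simp add: carrier_relative_homology_group)
  then have "homologous_rel_set p (nsphere n) ?D x
      \<in> hom_induced (int p) ?U ?E (nsphere n) ?D id ` carrier (relative_homology_group (int p) ?U ?E)"
    using iso_relative_homology_group_upper_hemisphere [of "int p" n k]
    by (simp add: iso_iff)
  then obtain y where y: "singular_relcycle p ?U ?E y"
      "homologous_rel_set p (nsphere n) ?D x
        = hom_induced (int p) ?U ?E (nsphere n) ?D id (homologous_rel_set p ?U ?E y)"
    by (auto simp: carrier_relative_homology_group)
  have "hom_induced (int p) ?U ?E (nsphere n) ?D id (homologous_rel_set p ?U ?E y)
        = homologous_rel_set p (nsphere n) ?D (chain_map p id y)"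
    by (rule hom_induced_chain_map) (use y in \<open>auto simp: continuous_map_from_subtopology\<close>)
  moreover have "chain_map p id y = y"
    using y(1) chain_map_ident singular_relcycle by metis
  ultimately show thesis
    using that y by (simp add: homologous_rel_set_eq)
qed

text \<open>Injectivity of the same isomorphism.\<close>

lemma hemisphere_homologous_rel:
  assumes a: "singular_relcycle p (subtopology (nsphere n) {x. 0 \<le> x k}) {x. x k = 0} a"
    and b: "singular_relcycle p (subtopology (nsphere n) {x. 0 \<le> x k}) {x. x k = 0} b"
    and ab: "homologous_rel p (nsphere n) {x. x k \<le> 0} a b"
  shows "homologous_rel p (subtopology (nsphere n) {x. 0 \<le> x k}) {x. x k = 0} a b"
proof -
  let ?U = "subtopology (nsphere n) {x. 0 \<le> x k}" and ?E = "{x. x k = (0::real)}"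
  let ?D = "{x. x k \<le> (0::real)}"
  have *: "hom_induced (int p) ?U ?E (nsphere n) ?D id (homologous_rel_set p ?U ?E y)
        = homologous_rel_set p (nsphere n) ?D y" if "singular_relcycle p ?U ?E y" for y
  proof -
    have "hom_induced (int p) ?U ?E (nsphere n) ?D id (homologous_rel_set p ?U ?E y)
        = homologous_rel_set p (nsphere n) ?D (chain_map p id y)"
      by (rule hom_induced_chain_map) (use that in \<open>auto simp: continuous_map_from_subtopology\<close>)
    moreover have "chain_map p id y = y"
      using that chain_map_ident singular_relcycle by metis
    ultimately show ?thesis by simp
  qed
  have "homologous_rel_set p ?U ?E a = homologous_rel_set p ?U ?E b"
  proof (rule inj_onD)
    show "inj_on (hom_induced (int p) ?U ?E (nsphere n) ?D id) (carrier (relative_homology_group (int p) ?U ?E))"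
      using iso_relative_homology_group_upper_hemisphere [of "int p" n k] by (simp add: iso_iff)
    show "hom_induced (int p) ?U ?E (nsphere n) ?D id (homologous_rel_set p ?U ?E a)
        = hom_induced (int p) ?U ?E (nsphere n) ?D id (homologous_rel_set p ?U ?E b)"
      using ab by (simp add: * a b homologous_rel_set_eq)
  qed (use a b in \<open>auto simp: carrier_relative_homology_group\<close>)
  then show ?thesis
    by (simp add: homologous_rel_set_eq)
qed

lemma sphere_chain_in_hemisphere:
  "sphere_chain c \<Longrightarrow> singular_chain n (subtopology (nsphere n) {x. 0 \<le> x n}) (c n)"
  by (simp add: sphere_chain_def)

lemma sphere_chain_in_nsphere:
  "sphere_chain c \<Longrightarrow> j \<le> n \<Longrightarrow> singular_chain j (nsphere n) (c j)"
  by (meson sphere_chain_def singular_chain_subtopology singular_chain_nsphere_mono)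

lemma sphere_chain_boundary:
  "sphere_chain c \<Longrightarrow> chain_boundary (Suc n) (c (Suc n)) = antipodal_sum n (c n)"
  by (simp add: sphere_chain_def)

lemma sphere_chain_cycle:
  assumes "sphere_chain c"
  shows "singular_relcycle n (nsphere n) {} (antipodal_sum n (c n))"
proof (rule singular_cycle_antipodal_sum)
  show "singular_chain n (nsphere n) (c n)"
    using assms sphere_chain_in_nsphere by blast
  show "chain_boundary n (antipodal_sum n (c n)) = 0"
  proof (cases n)
    case (Suc m)
    then show ?thesis
      using chain_boundary_antipodal_sum sphere_chain_in_nsphere [OF assms, of _ n] sphere_chain_boundary [OF assms]
      by (metis le_SucI order_refl)
  qed (simp add: chain_boundary_def)
qed

lemma sphere_chain_relcycle:
  assumes "sphere_chain c"
  shows "singular_relcycle n (subtopology (nsphere n) {x. 0 \<le> x n}) {x. x n = 0} (c n)"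
proof (cases n)
  case 0
  then show ?thesis
    using sphere_chain_in_hemisphere [OF assms, of 0]
    by (simp add: singular_relcycle chain_boundary_def)
next
  case (Suc m)
  then show ?thesis
    using sphere_chain_in_hemisphere [OF assms, of n] sphere_chain_cycle [OF assms, of m]
    by (simp add: singular_relcycle sphere_chain_boundary [OF assms] flip: nsphere_eq_subtopology_hemisphere)
qed

text \<open>The antipodal copy of \<open>c n\<close> lies in the lower hemisphere, so modulo that
  hemisphere the fundamental cycle is just \<open>c n\<close>. Excision then moves the relation,
  with its factor 2, to the upper hemisphere modulo the equator.\<close>

lemma sphere_chain_even_imp_relative_even:
  assumes c: "sphere_chain c" and x: "singular_relcycle n (nsphere n) {} x"
    and h: "homologous_rel n (nsphere n) {} (antipodal_sum n (c n)) (frag_cmul 2 x)"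
  obtains y where "singular_relcycle n (subtopology (nsphere n) {x. 0 \<le> x n}) {x. x n = 0} y"
    "homologous_rel n (subtopology (nsphere n) {x. 0 \<le> x n}) {x. x n = 0} (c n) (frag_cmul 2 y)"
proof -
  let ?U = "subtopology (nsphere n) {x. 0 \<le> x n}" and ?E = "{x. x n = (0::real)}"
  let ?D = "{x. x n \<le> (0::real)}"
  have "singular_relcycle n (nsphere n) ?D x"
    using x unfolding singular_cycle by (simp add: singular_relcycle)
  then obtain y where y: "singular_relcycle n ?U ?E y" "homologous_rel n (nsphere n) ?D x y"
    by (rule hemisphere_relcycle)
  have "continuous_map ?U (subtopology (nsphere n) ?D) antipode"
    using continuous_map_antipode [of n]
    by (auto simp: continuous_map_in_subtopology continuous_map_from_subtopology antipode_def)
  then have "singular_chain n (subtopology (nsphere n) ?D) (chain_map n antipode (c n))"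
    using sphere_chain_in_hemisphere [OF c] singular_chain_chain_map by blast
  then have "singular_relboundary n (nsphere n) ?D (frag_cmul ((-1) ^ Suc n) (chain_map n antipode (c n)))"
    by (intro singular_chain_imp_relboundary singular_chain_cmul)
  then have "homologous_rel n (nsphere n) ?D (antipodal_sum n (c n)) (c n)"
    by (simp add: homologous_rel_def)
  then have "homologous_rel n (nsphere n) ?D (c n) (antipodal_sum n (c n))"
    by (subst homologous_rel_sym)
  from homologous_rel_trans [OF homologous_rel_empty_imp [OF h] this]
  have "homologous_rel n (nsphere n) ?D (c n) (frag_cmul 2 x)" .
  from homologous_rel_trans [OF homologous_rel_cmul [OF y(2)] this]
  have "homologous_rel n (nsphere n) ?D (c n) (frag_cmul 2 y)" .
  then have "homologous_rel n ?U ?E (c n) (frag_cmul 2 y)"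
    by (intro hemisphere_homologous_rel sphere_chain_relcycle [OF c] singular_relcycle_cmul y(1))
  with y(1) show thesis by (rule that)
qed

text \<open>Excision of the lower hemisphere turns divisibility by 2 of the fundamental cycle into
  divisibility of the hemisphere chain modulo the equator, whose boundary is the fundamental cycle one
  dimension lower.\<close>

lemma sphere_chain_not_even:
  assumes c: "sphere_chain c" and "singular_relcycle n (nsphere n) {} x"
  shows "\<not> homologous_rel n (nsphere n) {} (antipodal_sum n (c n)) (frag_cmul 2 x)"
  using assms(2)
proof (induction n arbitrary: x)
  case 0
  let ?U = "subtopology (nsphere 0) {x. 0 \<le> x 0}" and ?E = "{x. x 0 = (0::real)}"
  let ?a = "(\<lambda>n. if n = 0 then 1 else 0) :: nat \<Rightarrow> real"
  show ?case
  proof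
    assume "homologous_rel 0 (nsphere 0) {} (antipodal_sum 0 (c 0)) (frag_cmul 2 x)"
    from sphere_chain_even_imp_relative_even [OF c 0 this] obtain y
      where y: "homologous_rel 0 ?U ?E (c 0) (frag_cmul 2 y)" by blast
    \<comment> \<open>The upper half of S^0 is one point and misses the equator, so the relation is
      absolute. Boundaries in degree 0 vanish on a point, and \<open>c 0\<close> has the odd
      coefficient 1 at its only simplex.\<close>
    have U: "topspace ?U = {?a}"
      by (auto simp: nsphere power2_eq_1_iff)
    then have "topspace ?U \<inter> ?E = {}"
      by auto
    then have "homologous_rel 0 ?U {} (c 0) (frag_cmul 2 y)"
      using y homologous_rel_restrict [of 0 ?U ?E] by metis
    then have "singular_relboundary 0 ?U {} (c 0 - frag_cmul 2 y)"
      by (simp only: homologous_rel_def)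
    then have "c 0 = frag_cmul 2 y"
      using singular_boundary_singleton [OF U] by simp
    then have "frag_of (restrict (\<lambda>_. ?a) (standard_simplex 0)) = frag_cmul 2 y"
      using c by (simp add: sphere_chain_def)
    then have "1 = 2 * Poly_Mapping.lookup y (restrict (\<lambda>_. ?a) (standard_simplex 0))"
      by (metis lookup_frag_cmul lookup_frag_of)
    then show False
      by presburger
  qed
next
  case (Suc m)
  let ?U = "subtopology (nsphere (Suc m)) {x. 0 \<le> x (Suc m)}" and ?E = "{x. x (Suc m) = (0::real)}"
  show ?case
  proof
    assume "homologous_rel (Suc m) (nsphere (Suc m)) {} (antipodal_sum (Suc m) (c (Suc m))) (frag_cmul 2 x)"
    from sphere_chain_even_imp_relative_even [OF c Suc.prems this] obtain y
      where y: "singular_relcycle (Suc m) ?U ?E y" "homologous_rel (Suc m) ?U ?E (c (Suc m)) (frag_cmul 2 y)" by blast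
    then obtain d e where d: "singular_chain (Suc (Suc m)) ?U d"
      and e: "singular_chain (Suc m) (subtopology ?U ?E) e"
      and de: "chain_boundary (Suc (Suc m)) d = c (Suc m) - frag_cmul 2 y + e"
      unfolding homologous_rel_def singular_relboundary_alt by blast
    \<comment> \<open>The boundary of the relation \<open>de\<close> shows that \<open>- e\<close>,
      which lives on the equator S^m, fills the fundamental cycle of S^m minus twice a
      cycle.\<close>
    have "chain_boundary (Suc m) (c (Suc m) - frag_cmul 2 y + e) = 0"
      using chain_boundary_boundary_alt [OF d] de by simp
    then have "chain_boundary (Suc m) e + (antipodal_sum m (c m) - frag_cmul 2 (chain_boundary (Suc m) y)) = 0"
      by (simp only: chain_boundary_add chain_boundary_diff chain_boundary_cmul
          sphere_chain_boundary [OF c] add.commute)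
    then have "chain_boundary (Suc m) (- e) = antipodal_sum m (c m) - frag_cmul 2 (chain_boundary (Suc m) y)"
      unfolding chain_boundary_minus by (rule minus_unique)
    then have "homologous_rel m (nsphere m) {} (antipodal_sum m (c m)) (frag_cmul 2 (chain_boundary (Suc m) y))"
      using e unfolding homologous_rel_def singular_boundary
      by (metis nsphere_eq_subtopology_hemisphere singular_chain_minus)
    moreover have "singular_relcycle m (nsphere m) {} (chain_boundary (Suc m) y)"
      using y(1) chain_boundary_boundary_alt [of m ?U y] unfolding singular_cycle
      by (simp add: singular_relcycle flip: nsphere_eq_subtopology_hemisphere)
    ultimately show False
      using Suc.IH by blast
  qed
qed

section \<open>Odd and even maps applied to the fundamental cycle\<close>

lemma antipodal_sum_diff:
  "antipodal_sum p (a - b) = antipodal_sum p a - antipodal_sum p b"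
  by (simp add: chain_map_diff frag_cmul_diff)

text \<open>Mirror image of \<open>antipodal_sum_antipodal_sum\<close> with the factors exchanged:
  corrections of this shape can be added to a chain without changing its antipodal sum.\<close>

lemma antipodal_sum_vanish:
  assumes "singular_chain p (nsphere n) e"
  shows "antipodal_sum p (e + frag_cmul ((-1) ^ p) (chain_map p antipode e)) = 0"
  by (simp add: chain_map_antipode_antipode [OF assms] chain_map_add frag_cmul_distrib2
      flip: power_add frag_cmul_distrib)

text \<open>The boundary lowers the degree but keeps the sign, so a symmetrised correction in degree
  \<open>Suc p\<close> bounds an antipodal sum in degree \<open>p\<close>. This carries the filling
  in \<open>odd_map_chain\<close> up one degree.\<close>

lemma chain_boundary_antipodal_sum_eq:
  assumes "singular_chain (Suc p) (nsphere n) e"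
  shows "chain_boundary (Suc p) (e + frag_cmul ((-1) ^ Suc p) (chain_map (Suc p) antipode e))
    = antipodal_sum p (chain_boundary (Suc p) e)"
  by (simp add: chain_boundary_add chain_boundary_cmul chain_boundary_chain_map [OF assms])

lemma chain_map_antipodal_sum_odd:
  assumes f: "\<And>x. x \<in> topspace (nsphere n) \<Longrightarrow> f (antipode x) = antipode (f x)"
    and c: "singular_chain p (nsphere n) c"
  shows "chain_map p f (antipodal_sum p c) = antipodal_sum p (chain_map p f c)"
proof -
  have "chain_map p f (chain_map p antipode c) = chain_map p (f \<circ> antipode) c"
    by (simp add: chain_map_compose)
  also have "\<dots> = chain_map p (antipode \<circ> f) c"
    by (rule chain_map_eq [OF c]) (simp add: f)
  finally show ?thesis
    by (simp add: chain_map_add chain_map_compose)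
qed

text \<open>In degrees below \<open>n\<close> the difference between \<open>f\<close> and the identity on the chains \<open>c j\<close> is filled in
  equivariantly by chains \<open>e\<close>; only the top degree leaves a cycle \<open>w\<close>, and it enters through
  \<open>antipodal_sum n w\<close>, which is twice a class since the antipode acts by a sign.\<close>

lemma odd_map_chain:
  assumes c: "sphere_chain c" and contf: "continuous_map (nsphere n) (nsphere n) f"
    and f: "\<And>x. x \<in> topspace (nsphere n) \<Longrightarrow> f (antipode x) = antipode (f x)"
  shows "\<exists>x. singular_relcycle n (nsphere n) {} x \<and>
    homologous_rel n (nsphere n) {} (chain_map n f (antipodal_sum n (c n)))
      (antipodal_sum n (c n) + frag_cmul 2 x)"
proof -
  \<comment> \<open>\<open>?w j e\<close> is the defect of \<open>f\<close> on \<open>c j\<close>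
    after the symmetrised correction \<open>?e j e\<close>, which \<open>antipodal_sum\<close> does
    not see.\<close>
  let ?e = "\<lambda>j e. e + frag_cmul ((-1) ^ j) (chain_map j antipode e)"
  let ?w = "\<lambda>j e. chain_map j f (c j) - c j - ?e j e"
  have c': "singular_chain j (nsphere n) (c j)" if "j \<le> n" for j
    using sphere_chain_in_nsphere [OF c that] .
  have odd: "chain_map j f (antipodal_sum j (c j)) = antipodal_sum j (chain_map j f (c j))" if "j \<le> n" for j
    by (rule chain_map_antipodal_sum_odd [OF _ c' [OF that]]) (rule f)
  have sum: "antipodal_sum j (chain_map j f (c j) - c j) = antipodal_sum j (?w j e)"
    if "singular_chain j (nsphere n) e" for j e
    using antipodal_sum_vanish [OF that] by (simp only: antipodal_sum_diff) simp
  have "\<exists>e. singular_chain j (nsphere n) e \<and> reduced_cycle j (nsphere n) (?w j e)" if "j \<le> n" for j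
    using that
  proof (induction j)
    case 0
    \<comment> \<open>\<open>f\<close> keeps the coefficient sum of a 0-chain, so the correction 0
      suffices.\<close>
    have "chain_map 0 (\<lambda>x. ()) (chain_map 0 f (c 0)) = chain_map 0 ((\<lambda>x. ()) \<circ> f) (c 0)"
      by (simp only: chain_map_compose) simp
    then have "chain_map 0 (\<lambda>x. ()) (chain_map 0 f (c 0)) = chain_map 0 (\<lambda>x. ()) (c 0)"
      by (simp add: o_def)
    then have "reduced_cycle 0 (nsphere n) (?w 0 0)"
      using reduced_cycle_0_diff [OF singular_chain_chain_map [OF c' contf] c'] by simp
    then show ?case
      using singular_chain_0 by blast
  next
    case (Suc j)
    then obtain e where e: "singular_chain j (nsphere n) e" "reduced_cycle j (nsphere n) (?w j e)"
      by auto
    \<comment> \<open>Here j < n, where the reduced homology of the n-sphere vanishes.\<close>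
    have "singular_relboundary j (nsphere n) {} (?w j e)"
      using reduced_cycle_imp_boundary [OF _ e(2)] Suc.prems
      by (simp add: trivial_reduced_homology_group_nsphere)
    then obtain d where d: "singular_chain (Suc j) (nsphere n) d" "chain_boundary (Suc j) d = ?w j e"
      using singular_boundary by blast
    have cs: "singular_chain (Suc j) (nsphere n) (c (Suc j))"
      using c' Suc.prems by blast
    \<comment> \<open>The filling \<open>d\<close> of the old defect becomes the new correction: the
      uncorrected difference and \<open>?e (Suc j) d\<close> both have the antipodal sum of that
      defect as boundary.\<close>
    have "chain_boundary (Suc j) (chain_map (Suc j) f (c (Suc j)) - c (Suc j))
        = antipodal_sum j (chain_map j f (c j) - c j)"
      using odd [of j] Suc.prems
      by (simp only: chain_boundary_diff chain_boundary_chain_map [OF cs] sphere_chain_boundary [OF c]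
          antipodal_sum_diff diff_Suc_Suc diff_zero)
    also have "\<dots> = antipodal_sum j (?w j e)"
      by (rule sum [OF e(1)])
    also have "\<dots> = chain_boundary (Suc j) (?e (Suc j) d)"
      by (simp only: chain_boundary_antipodal_sum_eq [OF d(1)] d(2))
    finally have "chain_boundary (Suc j) (?w (Suc j) d) = 0"
      by (simp only: chain_boundary_diff [of _ "_ - _"] diff_self)
    moreover have "singular_chain (Suc j) (nsphere n) (?w (Suc j) d)"
      by (intro singular_chain_diff singular_chain_add singular_chain_cmul
          singular_chain_chain_map [OF _ continuous_map_antipode] singular_chain_chain_map [OF _ contf] cs d(1))
    ultimately have "reduced_cycle (Suc j) (nsphere n) (?w (Suc j) d)"
      by (intro reduced_cycle_Suc) (simp only: singular_cycle simp_thms)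
    with d(1) show ?case by blast
  qed
  then obtain e where e: "singular_chain n (nsphere n) e" "reduced_cycle n (nsphere n) (?w n e)"
    by blast
  obtain u where u: "singular_relcycle n (nsphere n) {} u"
      "homologous_rel n (nsphere n) {} (antipodal_sum n (?w n e)) (frag_cmul 2 u)"
    using antipodal_sum_even_class [OF e(2)] by blast
  have "chain_map n f (antipodal_sum n (c n)) - antipodal_sum n (c n) = antipodal_sum n (?w n e)"
    using odd [of n] sum [OF e(1)] by (simp only: antipodal_sum_diff)
  then have "chain_map n f (antipodal_sum n (c n)) = antipodal_sum n (c n) + antipodal_sum n (?w n e)"
    by (metis add_diff_cancel_left' diff_add_cancel add.commute)
  then have "homologous_rel n (nsphere n) {} (chain_map n f (antipodal_sum n (c n)))
      (antipodal_sum n (c n) + frag_cmul 2 u)"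
    using homologous_rel_add [OF homologous_rel_refl u(2)] by metis
  with u(1) show ?thesis by blast
qed

text \<open>Under an even map the images of the two hemispheres cancel when n is even and add up
  when n is odd. In the odd case the single image is a cycle, since its boundary is the cancelling
  sum in the even dimension n - 1.\<close>

lemma even_map_chain:
  assumes c: "sphere_chain c" and contg: "continuous_map (nsphere n) (nsphere n) g"
    and g: "\<And>x. x \<in> topspace (nsphere n) \<Longrightarrow> g (antipode x) = g x"
  shows "\<exists>x. singular_relcycle n (nsphere n) {} x \<and> chain_map n g (antipodal_sum n (c n)) = frag_cmul 2 x"
proof -
  have *: "chain_map j g (antipodal_sum j (c j))
      = chain_map j g (c j) + frag_cmul ((-1) ^ Suc j) (chain_map j g (c j))" if "j \<le> n" for j
  proof -
    have "chain_map j g (chain_map j antipode (c j)) = chain_map j (g \<circ> antipode) (c j)"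
      by (simp add: chain_map_compose)
    also have "\<dots> = chain_map j g (c j)"
      by (rule chain_map_eq [OF sphere_chain_in_nsphere [OF c that]]) (simp add: g)
    finally show ?thesis
      by (simp add: chain_map_add)
  qed
  show ?thesis
  proof (cases "even n")
    case True
    then have "chain_map n g (antipodal_sum n (c n)) = frag_cmul 2 0"
      using * [of n] by simp
    then show ?thesis
      using singular_relcycle_0 by blast
  next
    case False
    then obtain m where m: "n = Suc m" "even m"
      by (metis even_Suc not0_implies_Suc even_zero)
    have cn: "singular_chain n (nsphere n) (c n)"
      using sphere_chain_in_nsphere [OF c] by blast
    have "chain_boundary n (chain_map n g (c n)) = chain_map m g (antipodal_sum m (c m))"
      using chain_boundary_chain_map [OF cn, of g] by (simp add: m sphere_chain_boundary [OF c])
    also have "\<dots> = 0"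
      using * [of m] m by simp
    finally have "singular_relcycle n (nsphere n) {} (chain_map n g (c n))"
      using singular_chain_chain_map [OF cn contg] by (simp add: singular_cycle)
    moreover have "chain_map n g (antipodal_sum n (c n)) = frag_cmul 2 (chain_map n g (c n))"
      using * [of n] frag_cmul_distrib [of 1 1 "chain_map n g (c n)"] False by simp
    ultimately show ?thesis by blast
  qed
qed

text \<open>Homotopic maps agree on homology, so z + 2x and 2y would be homologous for the
  fundamental cycle z, and z would be homologous to 2(y - x).\<close>

theorem odd_not_homotopic_even:
  assumes h: "homotopic_with (\<lambda>_. True) (nsphere n) (nsphere n) f g"
    and f: "\<And>x. x \<in> topspace (nsphere n) \<Longrightarrow> f (antipode x) = antipode (f x)"
    and g: "\<And>x. x \<in> topspace (nsphere n) \<Longrightarrow> g (antipode x) = g x"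
  shows False
proof -
  obtain c where c: "sphere_chain c"
    using sphere_chain_exists by blast
  let ?z = "antipodal_sum n (c n)"
  let ?h = "homologous_rel n (nsphere n) {}"
  have contf: "continuous_map (nsphere n) (nsphere n) f" and contg: "continuous_map (nsphere n) (nsphere n) g"
    using homotopic_with_imp_continuous_maps [OF h] by auto
  obtain x where x: "singular_relcycle n (nsphere n) {} x" "?h (chain_map n f ?z) (?z + frag_cmul 2 x)"
    using odd_map_chain [OF c contf f] by blast
  obtain y where y: "singular_relcycle n (nsphere n) {} y" "chain_map n g ?z = frag_cmul 2 y"
    using even_map_chain [OF c contg g] by blast
  have z: "singular_relcycle n (nsphere n) {} ?z"
    by (rule sphere_chain_cycle [OF c])
  have "homologous_rel_set n (nsphere n) {} (chain_map n f ?z) = homologous_rel_set n (nsphere n) {} (chain_map n g ?z)"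
    using homology_homotopy_empty [OF h, of n] hom_induced_chain_map [OF contf _ z, of "{}"]
      hom_induced_chain_map [OF contg _ z, of "{}"]
    by simp
  then have "?h (chain_map n f ?z) (frag_cmul 2 y)"
    using y by (simp add: homologous_rel_set_eq)
  moreover have "?h (?z + frag_cmul 2 x) (chain_map n f ?z)"
    using x(2) by (subst homologous_rel_sym)
  ultimately have "?h (?z + frag_cmul 2 x) (frag_cmul 2 y)"
    by (rule homologous_rel_trans)
  then have "?h (?z + frag_cmul 2 x - frag_cmul 2 x) (frag_cmul 2 y - frag_cmul 2 x)"
    by (rule homologous_rel_diff) simp
  then have "?h ?z (frag_cmul 2 (y - x))"
    by (simp add: frag_cmul_diff)
  moreover have "singular_relcycle n (nsphere n) {} (y - x)"
    using x y by (simp add: singular_relcycle_diff)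
  ultimately show False
    using sphere_chain_not_even [OF c] by blast
qed

theorem odd_even_homotopy_has_zero:
  fixes F :: "nat \<Rightarrow> real \<times> (nat \<Rightarrow> real) \<Rightarrow> real"
  assumes cont: "\<And>i. i \<le> n \<Longrightarrow>
      continuous_map (prod_topology (top_of_set {0..1}) (nsphere n)) euclideanreal (F i)"
    and odd: "\<And>i x. \<lbrakk>i \<le> n; x \<in> topspace (nsphere n)\<rbrakk> \<Longrightarrow> F i (0, antipode x) = - F i (0, x)"
    and even: "\<And>i x. \<lbrakk>i \<le> n; x \<in> topspace (nsphere n)\<rbrakk> \<Longrightarrow> F i (1, antipode x) = F i (1, x)"
  shows "\<exists>t\<in>{0..1}. \<exists>x\<in>topspace (nsphere n). \<forall>i\<le>n. F i (t, x) = 0"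
proof (rule ccontr)
  assume no_zero: "\<not> ?thesis"
  let ?X = "prod_topology (top_of_set {0..1::real}) (nsphere n)"
  define N where "N = (\<lambda>p. \<Sum>j\<le>n. (F j p)\<^sup>2)"
  \<comment> \<open>Points of \<open>nsphere n\<close> are sequences supported on 0, ..., n, hence
    the value 0 beyond n.\<close>
  define h where "h = (\<lambda>p i. if i \<le> n then F i p / sqrt (N p) else 0)"
  have N: "N p > 0" if pX: "p \<in> topspace ?X" for p
  proof -
    obtain t x where p: "p = (t, x)" "t \<in> {0..1}" "x \<in> topspace (nsphere n)"
      using pX by (cases p) auto
    obtain i where "i \<le> n" "F i p \<noteq> 0"
      using no_zero p(2,3) unfolding p(1) by blast
    then show ?thesis
      unfolding N_def by (intro sum_pos2 [of _ i]) auto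
  qed
  have "continuous_map ?X (powertop_real UNIV) h"
    unfolding continuous_map_componentwise_UNIV
  proof
    fix i
    show "continuous_map ?X euclideanreal (\<lambda>p. h p i)"
    proof (cases "i \<le> n")
      case True
      have "continuous_map ?X euclideanreal N"
        unfolding N_def by (intro continuous_map_sum continuous_map_real_pow cont) auto
      then have "continuous_map ?X euclideanreal (\<lambda>p. F i p / sqrt (N p))"
        using N True by (intro continuous_map_real_divide continuous_map_sqrt cont) force+
      then show ?thesis
        using True by (simp add: h_def)
    qed (simp add: h_def)
  qed
  moreover have "h p \<in> {x. (\<Sum>i\<le>n. (x i)\<^sup>2) = 1 \<and> (\<forall>i>n. x i = 0)}" if "p \<in> topspace ?X" for p
  proof -
    have "(\<Sum>i\<le>n. (h p i)\<^sup>2) = (\<Sum>i\<le>n. (F i p)\<^sup>2 / N p)"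
      using N [OF that] by (intro sum.cong) (auto simp: h_def power_divide)
    also have "\<dots> = 1"
      using N [OF that] by (simp add: N_def flip: sum_divide_distrib)
    finally show ?thesis
      by (simp add: h_def)
  qed
  ultimately have "continuous_map ?X (nsphere n) h"
    by (subst (2) nsphere) (simp add: continuous_map_in_subtopology image_subset_iff)
  then have "homotopic_with (\<lambda>_. True) (nsphere n) (nsphere n) (\<lambda>x. h (0, x)) (\<lambda>x. h (1, x))"
    unfolding homotopic_with_def by auto
  then show False
  proof (rule odd_not_homotopic_even)
    fix x assume x: "x \<in> topspace (nsphere n)"
    have "N (0, antipode x) = N (0, x)" "N (1, antipode x) = N (1, x)"
      unfolding N_def using odd even x by simp_all
    then show "h (0, antipode x) = antipode (h (0, x))" "h (1, antipode x) = h (1, x)"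
      using odd even x by (auto simp: h_def antipode_def)
  qed
qed

section \<open>Bisection and weak convergence\<close>

text \<open>Convergence in the topology of \<open>mass_space\<close>; sequences suffice because the
  parameters range over metric spaces.\<close>

definition weakly_converges :: "(nat \<Rightarrow> 'a::euclidean_space measure) \<Rightarrow> 'a measure \<Rightarrow> bool" where
  "weakly_converges Ms M \<longleftrightarrow> (\<forall>f :: 'a \<Rightarrow>\<^sub>C real.
     (\<lambda>n. \<integral>x. apply_bcontfun f x \<partial>Ms n) \<longlonglongrightarrow> (\<integral>x. apply_bcontfun f x \<partial>M))"

text \<open>The carrier of a mass is a moving subspace and its sigma-algebra may exceed the Borel
  one. Measurability of ambient continuous functions is what all these measures share.\<close>

definition finite_topological_measure :: "'a::euclidean_space measure \<Rightarrow> bool" where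
  "finite_topological_measure M \<longleftrightarrow> finite_measure M \<and>
     (\<forall>g :: 'a \<Rightarrow> real. continuous_on UNIV g \<longrightarrow> g \<in> borel_measurable M)"

lemma measurable_of_continuous:
  fixes g :: "'a::euclidean_space \<Rightarrow> real"
  shows "finite_topological_measure M \<Longrightarrow> continuous_on UNIV g \<Longrightarrow> g \<in> borel_measurable M"
  by (simp add: finite_topological_measure_def)

lemma hyperplane_measurable:
  fixes u :: "'a::euclidean_space"
  assumes "finite_topological_measure M"
  shows "{x \<in> space M. u \<bullet> x \<le> b} \<in> sets M" "{x \<in> space M. b \<le> u \<bullet> x} \<in> sets M"
    "{x \<in> space M. u \<bullet> x = b} \<in> sets M"
proof -
  have u: "(\<lambda>x. u \<bullet> x) \<in> borel_measurable M"
    by (rule measurable_of_continuous [OF assms]) (intro continuous_intros)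
  have b: "(\<lambda>x. b) \<in> borel_measurable M"
    by (rule borel_measurable_const)
  show "{x \<in> space M. u \<bullet> x \<le> b} \<in> sets M"
    by (rule borel_measurable_le [OF u b])
  show "{x \<in> space M. b \<le> u \<bullet> x} \<in> sets M"
    by (rule borel_measurable_le [OF b u])
  show "{x \<in> space M. u \<bullet> x = b} \<in> sets M"
    by (rule borel_measurable_eq [OF u b])
qed

section \<open>Integrals along weakly convergent sequences\<close>

lemma weakly_converges_integral:
  fixes g :: "'a::euclidean_space \<Rightarrow> real"
  assumes "weakly_converges Ms M" "continuous_on UNIV g" "\<And>x. \<bar>g x\<bar> \<le> B"
  shows "(\<lambda>n. \<integral>x. g x \<partial>Ms n) \<longlonglongrightarrow> (\<integral>x. g x \<partial>M)"
proof -
  have "g \<in> bcontfun"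
    using assms by (intro bcontfun_normI [of _ B]) auto
  then show ?thesis
    using assms(1) unfolding weakly_converges_def
    by (metis Bcontfun_inverse)
qed

lemma integrable_bounded_continuous:
  fixes g :: "'a::euclidean_space \<Rightarrow> real"
  assumes "finite_topological_measure M" "continuous_on UNIV g" "\<And>x. \<bar>g x\<bar> \<le> B"
  shows "integrable M g"
proof -
  interpret finite_measure M
    using assms by (simp add: finite_topological_measure_def)
  show ?thesis
    using assms by (intro integrable_const_bound [of _ B]) (auto simp: finite_topological_measure_def)
qed

lemma integral_bounded_tendsto:
  fixes f :: "nat \<Rightarrow> 'a::euclidean_space \<Rightarrow> real"
  assumes M: "finite_topological_measure M"
    and cont: "\<And>n. continuous_on UNIV (f n)" and bd: "\<And>n x. \<bar>f n x\<bar> \<le> B"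
    and lim: "\<And>x. (\<lambda>n. f n x) \<longlonglongrightarrow> g x" and g: "g \<in> borel_measurable M"
  shows "(\<lambda>n. \<integral>x. f n x \<partial>M) \<longlonglongrightarrow> (\<integral>x. g x \<partial>M)"
proof -
  interpret finite_measure M
    using assms by (simp add: finite_topological_measure_def)
  show ?thesis
  proof (rule integral_dominated_convergence [of _ _ _ "\<lambda>_. B"])
    show "f n \<in> borel_measurable M" for n
      by (rule measurable_of_continuous [OF M cont])
    show "AE x in M. norm (f n x) \<le> B" for n
      by (rule AE_I2) (simp add: bd)
  qed (simp_all add: g lim)
qed

text \<open>It is 0 on the ball of radius R and 1 outside radius R + 1, so its integral bounds the
  tail mass; being continuous, it passes to weak limits.\<close>

definition outer_cutoff :: "real \<Rightarrow> 'a::euclidean_space \<Rightarrow> real" where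
  "outer_cutoff R x = min 1 (max 0 (norm x - R))"

lemma outer_cutoff_bounds [simp]: "0 \<le> outer_cutoff R x" "outer_cutoff R x \<le> 1" "\<bar>outer_cutoff R x\<bar> \<le> 1"
  by (auto simp: outer_cutoff_def)

lemma continuous_outer_cutoff: "continuous_on UNIV (outer_cutoff R)"
  unfolding outer_cutoff_def by (intro continuous_intros)

lemma outer_cutoff_small:
  assumes "finite_topological_measure M" "e > 0"
  obtains R where "R \<ge> 0" "(\<integral>x. outer_cutoff R x \<partial>M) < e"
proof -
  have "(\<lambda>n. \<integral>x. outer_cutoff (real n) x \<partial>M) \<longlonglongrightarrow> (\<integral>x. 0 \<partial>M)"
  proof (rule integral_bounded_tendsto [OF assms(1) continuous_outer_cutoff outer_cutoff_bounds(3)])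
    fix x :: 'a
    obtain m where "norm x < real m" using reals_Archimedean2 by blast
    then have "\<forall>\<^sub>F n in sequentially. outer_cutoff (real n) x = 0"
      by (intro eventually_sequentiallyI [of m]) (auto simp: outer_cutoff_def)
    then show "(\<lambda>n. outer_cutoff (real n) x) \<longlonglongrightarrow> 0"
      by (rule tendsto_eventually)
  qed simp
  then have "\<forall>\<^sub>F n in sequentially. (\<integral>x. outer_cutoff (real n) x \<partial>M) < e"
    using assms(2) by (simp add: order_tendsto_iff)
  then obtain n :: nat where "(\<integral>x. outer_cutoff (real n) x \<partial>M) < e"
    using eventually_happens'[OF sequentially_bot] by blast
  then show thesis
    using that [of "real n"] by simp
qed

text \<open>Weak convergence forces tightness, because the limit has finite mass; this makes the
  integrals converge although the integrands only converge locally uniformly.\<close>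

lemma profile_integral_tendsto:
  fixes \<phi> :: "real \<Rightarrow> real" and u :: "nat \<Rightarrow> 'a::euclidean_space"
  assumes Ms: "\<And>n. finite_topological_measure (Ms n)" and M: "finite_topological_measure M"
    and conv: "weakly_converges Ms M" and u: "u \<longlonglongrightarrow> u0" and b: "b \<longlonglongrightarrow> b0"
    and lip: "L-lipschitz_on UNIV \<phi>" and bd: "\<And>s. \<bar>\<phi> s\<bar> \<le> B"
  shows "(\<lambda>n. \<integral>x. \<phi> (u n \<bullet> x - b n) \<partial>Ms n) \<longlonglongrightarrow> (\<integral>x. \<phi> (u0 \<bullet> x - b0) \<partial>M)"
proof -
  have cont\<phi>: "continuous_on UNIV \<phi>"
    using lip by (rule lipschitz_on_continuous_on)
  have cont: "continuous_on UNIV (\<lambda>x::'a. \<phi> (v \<bullet> x - c))" for v c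
    by (rule continuous_on_compose2 [OF cont\<phi>]) (auto intro!: continuous_intros)
  have "B \<ge> 0" "L \<ge> 0"
    using bd [of 0] lipschitz_on_nonneg [OF lip] by auto
  let ?D = "\<lambda>n. (\<integral>x. \<phi> (u n \<bullet> x - b n) \<partial>Ms n) - (\<integral>x. \<phi> (u0 \<bullet> x - b0) \<partial>Ms n)"
  have D: "\<bar>?D n\<bar> \<le> L * (norm (u n - u0) * (R + 1) + \<bar>b n - b0\<bar>) * measure (Ms n) (space (Ms n))
      + 2 * B * (\<integral>x. outer_cutoff R x \<partial>Ms n)" if "R \<ge> 0" for R n
  proof -
    interpret finite_measure "Ms n"
      using Ms by (simp add: finite_topological_measure_def)
    let ?\<delta> = "L * (norm (u n - u0) * (R + 1) + \<bar>b n - b0\<bar>)"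
    have int: "integrable (Ms n) (\<lambda>x. \<phi> (v \<bullet> x - c))" for v c
      by (rule integrable_bounded_continuous [OF Ms cont bd])
    have intc: "integrable (Ms n) (outer_cutoff R)"
      by (rule integrable_bounded_continuous [OF Ms continuous_outer_cutoff outer_cutoff_bounds(3)])
    \<comment> \<open>Inside radius R + 1 the Lipschitz condition and Cauchy-Schwarz give the first
      term; outside, the cutoff is 1 and 2 * B bounds any difference of values.\<close>
    have le: "\<bar>\<phi> (u n \<bullet> x - b n) - \<phi> (u0 \<bullet> x - b0)\<bar> \<le> ?\<delta> + 2 * B * outer_cutoff R x" for x
    proof (cases "norm x \<le> R + 1")
      case True
      have "\<bar>\<phi> (u n \<bullet> x - b n) - \<phi> (u0 \<bullet> x - b0)\<bar> \<le> L * \<bar>(u n \<bullet> x - b n) - (u0 \<bullet> x - b0)\<bar>"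
        using lipschitz_onD [OF lip, of "u n \<bullet> x - b n" "u0 \<bullet> x - b0"] by (simp add: dist_real_def)
      also have "(u n \<bullet> x - b n) - (u0 \<bullet> x - b0) = (u n - u0) \<bullet> x - (b n - b0)"
        by (simp add: inner_diff_left)
      also have "\<bar>\<dots>\<bar> \<le> \<bar>(u n - u0) \<bullet> x\<bar> + \<bar>b n - b0\<bar>"
        by linarith
      also have "\<bar>(u n - u0) \<bullet> x\<bar> \<le> norm (u n - u0) * norm x"
        by (rule Cauchy_Schwarz_ineq2)
      also have "\<dots> \<le> norm (u n - u0) * (R + 1)"
        using True by (simp add: mult_left_mono)
      finally have "\<bar>\<phi> (u n \<bullet> x - b n) - \<phi> (u0 \<bullet> x - b0)\<bar> \<le> ?\<delta>"
        using \<open>L \<ge> 0\<close> by (simp add: mult_left_mono)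
      moreover have "0 \<le> 2 * B * outer_cutoff R x"
        using \<open>B \<ge> 0\<close> by simp
      ultimately show ?thesis
        by linarith
    next
      case False
      then have "outer_cutoff R x = 1"
        by (simp add: outer_cutoff_def)
      moreover have "0 \<le> ?\<delta>"
        using \<open>L \<ge> 0\<close> that by simp
      ultimately show ?thesis
        using bd [of "u n \<bullet> x - b n"] bd [of "u0 \<bullet> x - b0"] by (simp only: mult_1_right)
    qed
    have "\<bar>?D n\<bar> = \<bar>\<integral>x. \<phi> (u n \<bullet> x - b n) - \<phi> (u0 \<bullet> x - b0) \<partial>Ms n\<bar>"
      by (simp add: int)
    also have "\<dots> \<le> (\<integral>x. \<bar>\<phi> (u n \<bullet> x - b n) - \<phi> (u0 \<bullet> x - b0)\<bar> \<partial>Ms n)"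
      by (rule integral_abs_bound)
    also have "\<dots> \<le> (\<integral>x. ?\<delta> + 2 * B * outer_cutoff R x \<partial>Ms n)"
      by (rule integral_mono) (auto simp: int intc le)
    also have "\<dots> = ?\<delta> * measure (Ms n) (space (Ms n)) + 2 * B * (\<integral>x. outer_cutoff R x \<partial>Ms n)"
      by (simp add: intc mult.commute)
    finally show ?thesis .
  qed
  have mass: "(\<lambda>n. measure (Ms n) (space (Ms n))) \<longlonglongrightarrow> measure M (space M)"
    using weakly_converges_integral [OF conv, of "\<lambda>_. 1" 1] by simp
  have "?D \<longlonglongrightarrow> 0"
  proof (rule LIMSEQ_I)
    fix e :: real assume "e > 0"
    \<comment> \<open>Chosen so that 2 * B times this stays below e; B + 1 replaces B because B may
      be 0.\<close>
    then have "e / (4 * (B + 1)) > 0"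
      using \<open>B \<ge> 0\<close> by simp
    then obtain R where R: "R \<ge> 0" "(\<integral>x. outer_cutoff R x \<partial>M) < e / (4 * (B + 1))"
      using outer_cutoff_small [OF M] by blast
    have "(\<lambda>n. L * (norm (u n - u0) * (R + 1) + \<bar>b n - b0\<bar>) * measure (Ms n) (space (Ms n))
      + 2 * B * (\<integral>x. outer_cutoff R x \<partial>Ms n))
      \<longlonglongrightarrow> L * (norm (u0 - u0) * (R + 1) + \<bar>b0 - b0\<bar>) * measure M (space M) + 2 * B * (\<integral>x. outer_cutoff R x \<partial>M)"
      by (intro tendsto_intros u b mass weakly_converges_integral [OF conv continuous_outer_cutoff outer_cutoff_bounds(3)])
    moreover have "2 * B * (\<integral>x. outer_cutoff R x \<partial>M) < e"
    proof -
      have "2 * B * (\<integral>x. outer_cutoff R x \<partial>M) \<le> 2 * B * (e / (4 * (B + 1)))"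
        using R \<open>B \<ge> 0\<close> by (intro mult_left_mono) auto
      also have "\<dots> < e"
        using \<open>B \<ge> 0\<close> \<open>e > 0\<close> by (simp add: field_simps add_pos_nonneg)
      finally show ?thesis .
    qed
    ultimately have "\<forall>\<^sub>F n in sequentially. L * (norm (u n - u0) * (R + 1) + \<bar>b n - b0\<bar>) * measure (Ms n) (space (Ms n))
      + 2 * B * (\<integral>x. outer_cutoff R x \<partial>Ms n) < e"
      by (intro order_tendstoD(2)) auto
    then have "\<forall>\<^sub>F n in sequentially. norm (?D n - 0) < e"
      by eventually_elim (use D [OF R(1)] in \<open>auto intro: le_less_trans\<close>)
    then show "\<exists>no. \<forall>n\<ge>no. norm (?D n - 0) < e"
      by (simp only: eventually_sequentially)
  qed
  \<comment> \<open>With the profile frozen at \<open>u0\<close> and \<open>b0\<close> only the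
    measures vary, which is plain weak convergence.\<close>
  from tendsto_add [OF this weakly_converges_integral [OF conv cont [of u0 b0] bd]]
  show ?thesis by simp
qed

section \<open>Soft signs and ramps\<close>

definition soft_sign :: "real \<Rightarrow> real \<Rightarrow> real" where
  "soft_sign N s = 2 / pi * arctan (N * s)"

lemma soft_sign_minus: "soft_sign N (- s) = - soft_sign N s"
  by (simp add: soft_sign_def arctan_minus)

lemma soft_sign_less: "0 < N \<Longrightarrow> s < t \<Longrightarrow> soft_sign N s < soft_sign N t"
  by (simp add: soft_sign_def arctan_less_iff divide_strict_right_mono)

lemma soft_sign_mono: "0 < N \<Longrightarrow> s \<le> t \<Longrightarrow> soft_sign N s \<le> soft_sign N t"
  using soft_sign_less [of N s t] by (cases "s = t") auto

lemma soft_sign_bound: "\<bar>soft_sign N s\<bar> \<le> 1"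
  using arctan_bounded [of "N * s"] by (auto simp: soft_sign_def field_simps abs_le_iff)

lemma soft_sign_lipschitz:
  assumes "0 \<le> N"
  shows "(2 / pi * N)-lipschitz_on UNIV (soft_sign N)"
proof -
  have "\<bar>arctan a - arctan b\<bar> \<le> \<bar>a - b\<bar>" for a b :: real
  proof -
    have "norm (arctan a - arctan b) \<le> 1 * norm (a - b)"
    proof (rule field_differentiable_bound [of UNIV])
      show "(arctan has_field_derivative inverse (1 + x\<^sup>2)) (at x within UNIV)" for x :: real
        using DERIV_arctan by simp
      show "norm (inverse (1 + x\<^sup>2)) \<le> 1" for x :: real
        by (simp add: inverse_le_1_iff)
    qed auto
    then show ?thesis by simp
  qed
  then have "\<bar>arctan (N * a) - arctan (N * b)\<bar> \<le> N * \<bar>a - b\<bar>" for a b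
    using assms by (metis abs_mult abs_of_nonneg right_diff_distrib)
  then have "2 / pi * \<bar>arctan (N * a) - arctan (N * b)\<bar> \<le> 2 / pi * (N * \<bar>a - b\<bar>)" for a b
    by (intro mult_left_mono) auto
  moreover have "\<bar>soft_sign N a - soft_sign N b\<bar> = 2 / pi * \<bar>arctan (N * a) - arctan (N * b)\<bar>" for a b
    unfolding soft_sign_def right_diff_distrib [symmetric] abs_mult by simp
  ultimately show ?thesis
    using assms by (intro lipschitz_onI) (auto simp: dist_real_def mult.assoc)
qed

lemma soft_sign_at_top: "0 < s \<Longrightarrow> ((\<lambda>N. soft_sign N s) \<longlongrightarrow> 1) at_top"
proof -
  assume "0 < s"
  then have "filterlim (\<lambda>N. N * s) at_top at_top"
    by (intro filterlim_at_top_mult_tendsto_pos [of _ s] tendsto_const filterlim_ident) auto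
  then have "((\<lambda>N. arctan (N * s)) \<longlongrightarrow> pi / 2) at_top"
    by (rule filterlim_compose [OF tendsto_arctan_at_top])
  then have "((\<lambda>N. 2 / pi * arctan (N * s)) \<longlongrightarrow> 2 / pi * (pi / 2)) at_top"
    by (intro tendsto_intros)
  then show ?thesis
    by (simp add: soft_sign_def)
qed

text \<open>A continuous majorant of the limit of \<open>soft_sign N\<close>: it equals \<open>1\<close> on \<open>s \<ge> - 1 / m\<close> and \<open>- 1\<close> on
  \<open>s \<le> - 2 / m\<close>.\<close>

definition ramp :: "real \<Rightarrow> real \<Rightarrow> real" where
  "ramp m s = max (- 1) (min 1 (3 + 2 * m * s))"

lemma ramp_bound: "\<bar>ramp m s\<bar> \<le> 1"
  unfolding ramp_def by (intro abs_leI) (simp_all add: max_def min_def)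

lemma ramp_lipschitz:
  assumes "0 \<le> m"
  shows "(2 * m)-lipschitz_on UNIV (ramp m)"
proof (rule lipschitz_onI)
  fix s t
  have "\<bar>max (- 1) x - max (- 1) y\<bar> \<le> \<bar>x - y\<bar>" "\<bar>min 1 x - min 1 y\<bar> \<le> \<bar>x - y\<bar>" for x y :: real
    by linarith+
  then have "\<bar>ramp m s - ramp m t\<bar> \<le> \<bar>(3 + 2 * m * s) - (3 + 2 * m * t)\<bar>"
    unfolding ramp_def by (rule order_trans)
  also have "\<dots> = 2 * m * \<bar>s - t\<bar>"
    using assms by (simp add: abs_mult flip: right_diff_distrib)
  finally show "dist (ramp m s) (ramp m t) \<le> 2 * m * dist s t"
    by (simp add: dist_real_def)
qed (use assms in simp)

text \<open>Right of -1/m the ramp is 1. Left of it, monotonicity and oddness push the soft sign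
  below -1 + e. The bound is uniform in s, and N enters only through the value at 1/m.\<close>

lemma soft_sign_le_ramp:
  assumes "0 < m" "0 < N" "1 - e \<le> soft_sign N (1 / m)" "0 \<le> e"
  shows "soft_sign N s \<le> ramp m s + e"
proof (cases "s \<ge> - (1 / m)")
  case True
  then have "- 1 \<le> m * s"
    using assms(1) by (simp add: field_simps)
  then have "ramp m s = 1"
    by (auto simp: ramp_def)
  then show ?thesis
    using soft_sign_bound [of N s] assms by linarith
next
  case False
  then have "soft_sign N s \<le> soft_sign N (- (1 / m))"
    using assms by (intro soft_sign_mono) auto
  then show ?thesis
    using assms ramp_bound [of m s] by (simp add: soft_sign_minus)
qed

text \<open>The limit is 1 at s = 0, so it counts closed halfspaces, the ones measured in
  \<open>bisects\<close>. For s < 0 the ramp has reached -1 as soon as n * (-s) > 2.\<close>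

lemma ramp_tendsto:
  "(\<lambda>n. ramp (real (Suc n)) s) \<longlonglongrightarrow> (if s \<ge> 0 then 1 else - 1)"
proof (cases "s \<ge> 0")
  case True
  then show ?thesis
    by (simp add: ramp_def)
next
  case False
  then obtain m :: nat where "2 / - s < real m"
    using reals_Archimedean2 by blast
  then have "2 < real m * - s"
    using False by (simp add: field_simps)
  then have "ramp (real (Suc n)) s = - 1" if "n \<ge> m" for n
  proof -
    have "real m * - s \<le> real (Suc n) * - s"
      using that False by (intro mult_right_mono) auto
    then have "3 + 2 * (real (Suc n) * s) < - 1"
      using \<open>2 < real m * - s\<close> by linarith
    then show ?thesis
      unfolding ramp_def mult.assoc by linarith
  qed
  then show ?thesis
    using False by (intro tendsto_eventually eventually_sequentiallyI [of m]) auto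
qed

lemma continuous_profile:
  fixes v :: "'a::euclidean_space" and \<phi> :: "real \<Rightarrow> real"
  assumes "L-lipschitz_on UNIV \<phi>"
  shows "continuous_on UNIV (\<lambda>x. \<phi> (v \<bullet> x - c))"
  by (rule continuous_on_compose2 [OF lipschitz_on_continuous_on [OF assms]])
     (auto intro!: continuous_intros)

section \<open>Soft imbalance and its unique median\<close>

definition soft_imbalance :: "real \<Rightarrow> 'a::euclidean_space measure \<Rightarrow> 'a \<Rightarrow> real \<Rightarrow> real" where
  "soft_imbalance N M u b = (\<integral>x. soft_sign N (u \<bullet> x - b) \<partial>M)"

text \<open>The pair (-u, -b) is the same hyperplane with its sides exchanged. Apart from the
  oddness at t = 0, this is what turns upper bounds into lower ones.\<close>

lemma soft_imbalance_minus: "soft_imbalance N M (- u) (- b) = - soft_imbalance N M u b"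
proof -
  have "soft_sign N (- u \<bullet> x - - b) = - soft_sign N (u \<bullet> x - b)" for x
    using soft_sign_minus [of N "u \<bullet> x - b"] by (simp add: algebra_simps)
  then show ?thesis
    by (simp add: soft_imbalance_def)
qed

lemma integrable_soft_sign:
  assumes "finite_topological_measure M" "0 \<le> N"
  shows "integrable M (\<lambda>x. soft_sign N (u \<bullet> x - b))"
  using assms
  by (intro integrable_bounded_continuous [where B = 1] continuous_profile [OF soft_sign_lipschitz] soft_sign_bound)

lemma soft_imbalance_tendsto:
  assumes "\<And>n. finite_topological_measure (Ms n)" "finite_topological_measure M"
    "weakly_converges Ms M" "u \<longlonglongrightarrow> u0" "b \<longlonglongrightarrow> b0" "0 \<le> N"
  shows "(\<lambda>n. soft_imbalance N (Ms n) (u n) (b n)) \<longlonglongrightarrow> soft_imbalance N M u0 b0"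
  unfolding soft_imbalance_def
  by (rule profile_integral_tendsto [OF assms(1-5) soft_sign_lipschitz soft_sign_bound]) (use assms in auto)

lemma weakly_converges_const: "weakly_converges (\<lambda>_. M) M"
  by (simp add: weakly_converges_def)

lemma soft_imbalance_less:
  assumes M: "finite_topological_measure M" "measure M (space M) > 0" and "0 < N" "b < c"
  shows "soft_imbalance N M u c < soft_imbalance N M u b"
proof -
  interpret finite_measure M
    using M by (simp add: finite_topological_measure_def)
  show ?thesis
    unfolding soft_imbalance_def
  proof (rule integral_less_AE_space)
    show "emeasure M (space M) \<noteq> 0"
      using M(2) by (simp add: emeasure_eq_measure)
    show "AE x in M. soft_sign N (u \<bullet> x - c) < soft_sign N (u \<bullet> x - b)"
      using assms by (auto intro!: soft_sign_less)
  qed (use assms in \<open>auto intro!: integrable_soft_sign\<close>)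
qed

lemma soft_imbalance_at_top:
  assumes M: "finite_topological_measure M" and "0 < N"
  shows "(\<lambda>n. soft_imbalance N M u (real n)) \<longlonglongrightarrow> - measure M (space M)"
proof -
  have "(\<lambda>n. soft_imbalance N M u (real n)) \<longlonglongrightarrow> (\<integral>x. - 1 \<partial>M)"
    unfolding soft_imbalance_def
  proof (rule integral_bounded_tendsto [OF M _ soft_sign_bound])
    fix x
    have "filterlim (\<lambda>n. N * (real n - u \<bullet> x)) at_top sequentially"
      using \<open>0 < N\<close> by real_asymp
    then have "(\<lambda>n. arctan (N * (real n - u \<bullet> x))) \<longlonglongrightarrow> pi / 2"
      by (rule filterlim_compose [OF tendsto_arctan_at_top])
    then have "(\<lambda>n. - (2 / pi * arctan (N * (real n - u \<bullet> x)))) \<longlonglongrightarrow> - (2 / pi * (pi / 2))"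
      by (intro tendsto_intros)
    moreover have "- (2 / pi * arctan (N * (real n - u \<bullet> x))) = soft_sign N (u \<bullet> x - real n)" for n
      using soft_sign_minus [of N "real n - u \<bullet> x"] by (simp add: soft_sign_def)
    ultimately show "(\<lambda>n. soft_sign N (u \<bullet> x - real n)) \<longlonglongrightarrow> - 1"
      by simp
  qed (use assms in \<open>auto intro!: continuous_profile [OF soft_sign_lipschitz]\<close>)
  then show ?thesis by simp
qed

lemma soft_median_exists:
  assumes M: "finite_topological_measure M" "measure M (space M) > 0" and N: "0 < N"
  shows "\<exists>!b. soft_imbalance N M u b = 0"
proof -
  have ex: "\<exists>n. soft_imbalance N M v (real n) < 0" for v
  proof -
    have "\<forall>\<^sub>F n in sequentially. soft_imbalance N M v (real n) < 0"
      using order_tendstoD(2) [OF soft_imbalance_at_top [OF M(1) N], of 0 v] M(2) by simp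
    then show ?thesis
      using eventually_happens'[OF sequentially_bot] by blast
  qed
  obtain n where n: "soft_imbalance N M u (real n) < 0"
    using ex by blast
  \<comment> \<open>A positive value at a very negative offset comes from reversing the
    normal.\<close>
  obtain m where "soft_imbalance N M (- u) (real m) < 0"
    using ex by blast
  then have m: "0 < soft_imbalance N M u (- real m)"
    using soft_imbalance_minus [of N M u "- real m"] by simp
  have "- real m \<le> real n" by simp
  moreover have "continuous_on {- real m..real n} (\<lambda>b. soft_imbalance N M u b)"
    unfolding continuous_on_sequentially
    using N by (auto simp: o_def intro!: soft_imbalance_tendsto M weakly_converges_const)
  ultimately have "\<exists>b. - real m \<le> b \<and> b \<le> real n \<and> soft_imbalance N M u b = 0"
    using n m by (intro IVT2') auto
  then show ?thesis
    using soft_imbalance_less [OF M N] by (metis less_irrefl linorder_neqE_linordered_idom)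
qed

definition soft_median :: "real \<Rightarrow> 'a::euclidean_space measure \<Rightarrow> 'a \<Rightarrow> real" where
  "soft_median N M u = (THE b. soft_imbalance N M u b = 0)"

lemma soft_median_eq:
  assumes "finite_topological_measure M" "measure M (space M) > 0" "0 < N" "soft_imbalance N M u b = 0"
  shows "soft_median N M u = b"
  unfolding soft_median_def using soft_median_exists [OF assms(1-3)] assms(4) by (rule the1_equality)

lemma soft_imbalance_median:
  assumes "finite_topological_measure M" "measure M (space M) > 0" "0 < N"
  shows "soft_imbalance N M u (soft_median N M u) = 0"
  using soft_median_exists [OF assms] soft_median_eq [OF assms] by metis

lemma soft_median_minus:
  assumes "finite_topological_measure M" "measure M (space M) > 0" "0 < N"
  shows "soft_median N M (- u) = - soft_median N M u"
  by (rule soft_median_eq [OF assms]) (simp add: soft_imbalance_minus soft_imbalance_median [OF assms])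

text \<open>The imbalance decreases strictly in the offset, so its sign at b locates the median.
  Convergence and bounds of medians thereby reduce to imbalances at fixed offsets.\<close>

lemma soft_imbalance_sign_iff:
  assumes "finite_topological_measure M" "measure M (space M) > 0" "0 < N"
  shows "soft_imbalance N M u b < 0 \<longleftrightarrow> soft_median N M u < b"
    and "0 < soft_imbalance N M u b \<longleftrightarrow> b < soft_median N M u"
  using soft_imbalance_less [OF assms, of b "soft_median N M u" u]
    soft_imbalance_less [OF assms, of "soft_median N M u" b u] soft_imbalance_median [OF assms, of u]
  by (metis less_irrefl linorder_neqE_linordered_idom order.asym)+

lemma soft_median_tendsto:
  assumes Ms: "\<And>n. finite_topological_measure (Ms n)" "\<And>n. measure (Ms n) (space (Ms n)) > 0"
    and M: "finite_topological_measure M" "measure M (space M) > 0"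
    and conv: "weakly_converges Ms M" "u \<longlonglongrightarrow> u0" and N: "0 < N"
  shows "(\<lambda>n. soft_median N (Ms n) (u n)) \<longlonglongrightarrow> soft_median N M u0"
proof (rule order_tendstoI)
  have lim: "(\<lambda>n. soft_imbalance N (Ms n) (u n) b) \<longlonglongrightarrow> soft_imbalance N M u0 b" for b
    using N by (intro soft_imbalance_tendsto Ms M conv tendsto_const) auto
  show "\<forall>\<^sub>F n in sequentially. b < soft_median N (Ms n) (u n)" if "b < soft_median N M u0" for b
    using order_tendstoD(1) [OF lim [of b], of 0] that
    by (simp add: soft_imbalance_sign_iff [OF Ms N] soft_imbalance_sign_iff [OF M N])
  show "\<forall>\<^sub>F n in sequentially. soft_median N (Ms n) (u n) < b" if "soft_median N M u0 < b" for b
    using order_tendstoD(2) [OF lim [of b], of 0] that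
    by (simp add: soft_imbalance_sign_iff [OF Ms N] soft_imbalance_sign_iff [OF M N])
qed

section \<open>Letting the soft sign sharpen\<close>

lemma soft_imbalance_le_ramp:
  assumes M: "finite_topological_measure M" and m: "0 < m" and N: "0 < N"
    and e: "1 - e \<le> soft_sign N (1 / m)" "0 \<le> e"
  shows "soft_imbalance N M u b \<le> (\<integral>x. ramp m (u \<bullet> x - b) \<partial>M) + e * measure M (space M)"
proof -
  interpret finite_measure M
    using M by (simp add: finite_topological_measure_def)
  have ramp: "integrable M (\<lambda>x. ramp m (u \<bullet> x - b))"
    by (rule integrable_bounded_continuous [OF M continuous_profile [OF ramp_lipschitz] ramp_bound])
       (use m in simp)
  have "soft_imbalance N M u b \<le> (\<integral>x. ramp m (u \<bullet> x - b) + e \<partial>M)"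
    unfolding soft_imbalance_def
    using assms by (intro integral_mono integrable_soft_sign Bochner_Integration.integrable_add ramp soft_sign_le_ramp) auto
  also have "\<dots> = (\<integral>x. ramp m (u \<bullet> x - b) \<partial>M) + e * measure M (space M)"
    using ramp by (simp add: mult.commute)
  finally show ?thesis .
qed

text \<open>The Lipschitz constants of the soft signs grow with \<open>N n\<close>, so
  \<open>profile_integral_tendsto\<close> is applied to a ramp of fixed slope instead; the error
  \<open>1 - soft_sign (N n) (1 / m)\<close> tends to 0.\<close>

lemma soft_imbalance_limit_le:
  fixes u :: "nat \<Rightarrow> 'a::euclidean_space"
  assumes Ms: "\<And>n. finite_topological_measure (Ms n)" and M: "finite_topological_measure M"
    and conv: "weakly_converges Ms M" "u \<longlonglongrightarrow> u0" and N: "filterlim N at_top sequentially"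
    and less: "(\<integral>x. ramp m (u0 \<bullet> x - b0) \<partial>M) < 0" and m: "0 < m" and b: "b \<longlonglongrightarrow> b0"
  shows "\<forall>\<^sub>F n in sequentially. soft_imbalance (N n) (Ms n) (u n) (b n) < 0"
proof -
  let ?I = "\<integral>x. ramp m (u0 \<bullet> x - b0) \<partial>M" and ?m = "measure M (space M)"
  have "(\<lambda>n. \<integral>x. ramp m (u n \<bullet> x - b n) \<partial>Ms n) \<longlonglongrightarrow> ?I"
    using m by (intro profile_integral_tendsto [OF Ms M conv b ramp_lipschitz ramp_bound]) auto
  moreover have "(\<lambda>n. measure (Ms n) (space (Ms n))) \<longlonglongrightarrow> ?m"
    using weakly_converges_integral [OF conv(1), of "\<lambda>_. 1" 1] by simp
  moreover have sgn: "(\<lambda>n. soft_sign (N n) (1 / m)) \<longlonglongrightarrow> 1"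
    using m by (intro filterlim_compose [OF soft_sign_at_top N]) auto
  ultimately have "(\<lambda>n. (\<integral>x. ramp m (u n \<bullet> x - b n) \<partial>Ms n)
      + (1 - soft_sign (N n) (1 / m)) * measure (Ms n) (space (Ms n))) \<longlonglongrightarrow> ?I + (1 - 1) * ?m"
    by (intro tendsto_intros)
  then have "\<forall>\<^sub>F n in sequentially. (\<integral>x. ramp m (u n \<bullet> x - b n) \<partial>Ms n)
      + (1 - soft_sign (N n) (1 / m)) * measure (Ms n) (space (Ms n)) < 0"
    using less by (intro order_tendstoD(2)) auto
  moreover have "\<forall>\<^sub>F n in sequentially. 0 < N n"
    using N by (auto simp: filterlim_at_top_dense)
  ultimately show ?thesis
  proof eventually_elim
    case (elim n)
    have "0 \<le> 1 - soft_sign (N n) (1 / m)"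
      using soft_sign_bound [of "N n" "1 / m"] by simp
    with elim show ?case
      using soft_imbalance_le_ramp [OF Ms m, of "N n" "1 - soft_sign (N n) (1 / m)" n "u n" "b n"] by simp
  qed
qed

lemma ramp_at_top:
  assumes M: "finite_topological_measure M" and m: "0 < m"
  shows "(\<lambda>n. \<integral>x. ramp m (u \<bullet> x - real n) \<partial>M) \<longlonglongrightarrow> - measure M (space M)"
proof -
  have "(\<lambda>n. \<integral>x. ramp m (u \<bullet> x - real n) \<partial>M) \<longlonglongrightarrow> (\<integral>x. - 1 \<partial>M)"
  proof (rule integral_bounded_tendsto [OF M _ ramp_bound])
    fix x
    obtain k :: nat where k: "u \<bullet> x + 2 / m < real k"
      using reals_Archimedean2 by blast
    have "ramp m (u \<bullet> x - real n) = - 1" if "n \<ge> k" for n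
    proof -
      have "u \<bullet> x - real n \<le> - (2 / m)"
        using k that by linarith
      then have "m * (u \<bullet> x - real n) \<le> m * - (2 / m)"
        using m by (intro mult_left_mono) auto
      then have "m * (u \<bullet> x - real n) \<le> - 2"
        using m by simp
      then show ?thesis
        unfolding ramp_def mult.assoc by linarith
    qed
    then show "(\<lambda>n. ramp m (u \<bullet> x - real n)) \<longlonglongrightarrow> - 1"
      by (intro tendsto_eventually eventually_sequentiallyI [of k]) auto
  qed (use m in \<open>auto intro!: continuous_profile [OF ramp_lipschitz]\<close>)
  then show ?thesis by simp
qed

text \<open>At a far enough offset the ramp integral of the limit mass is negative. This forces a
  negative imbalance there, hence a smaller median, for all large n.\<close>

lemma soft_median_eventually_less:
  assumes Ms: "\<And>n. finite_topological_measure (Ms n)" "\<And>n. measure (Ms n) (space (Ms n)) > 0"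
    and M: "finite_topological_measure M" "measure M (space M) > 0"
    and conv: "weakly_converges Ms M" "u \<longlonglongrightarrow> u0"
    and N: "filterlim N at_top sequentially" "\<And>n. 0 < N n"
  shows "\<exists>B. \<forall>\<^sub>F n in sequentially. soft_median (N n) (Ms n) (u n) < B"
proof -
  have "\<forall>\<^sub>F n in sequentially. (\<integral>x. ramp 1 (u0 \<bullet> x - real n) \<partial>M) < 0"
    using order_tendstoD(2) [OF ramp_at_top [OF M(1), of 1 u0], of 0] M(2) by simp
  then obtain k :: nat where "(\<integral>x. ramp 1 (u0 \<bullet> x - real k) \<partial>M) < 0"
    using eventually_happens'[OF sequentially_bot] by blast
  from soft_imbalance_limit_le [OF Ms(1) M(1) conv N(1) this _ tendsto_const]
  have "\<forall>\<^sub>F n in sequentially. soft_imbalance (N n) (Ms n) (u n) (real k) < 0"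
    by simp
  then show ?thesis
    using soft_imbalance_sign_iff(1) [OF Ms N(2)] by (intro exI [of _ "real k"]) simp
qed

lemma soft_median_Bseq:
  assumes Ms: "\<And>n. finite_topological_measure (Ms n)" "\<And>n. measure (Ms n) (space (Ms n)) > 0"
    and M: "finite_topological_measure M" "measure M (space M) > 0"
    and conv: "weakly_converges Ms M" "u \<longlonglongrightarrow> u0"
    and N: "filterlim N at_top sequentially" "\<And>n. 0 < N n"
  shows "Bseq (\<lambda>n. soft_median (N n) (Ms n) (u n))"
proof -
  obtain B where B: "\<forall>\<^sub>F n in sequentially. soft_median (N n) (Ms n) (u n) < B"
    using soft_median_eventually_less [OF assms] by blast
  \<comment> \<open>The lower bound, by reversing the normals.\<close>
  obtain C where C: "\<forall>\<^sub>F n in sequentially. soft_median (N n) (Ms n) (- u n) < C"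
    using soft_median_eventually_less [OF Ms M conv(1) tendsto_minus [OF conv(2)] N] by blast
  have "\<forall>\<^sub>F n in sequentially. norm (soft_median (N n) (Ms n) (u n)) \<le> max B C"
    using B C by eventually_elim (auto simp: soft_median_minus [OF Ms N(2)])
  then show ?thesis
    by (rule BfunI)
qed

text \<open>A negative ramp integral of the limit would make the soft imbalances eventually negative
  instead of 0. So these integrals are nonnegative, and as the ramps steepen they tend to the mass
  of the closed halfspace minus that of its complement.\<close>

lemma halfspace_measure_le:
  fixes u :: "nat \<Rightarrow> 'a::euclidean_space"
  assumes Ms: "\<And>n. finite_topological_measure (Ms n)" and M: "finite_topological_measure M"
    and conv: "weakly_converges Ms M" "u \<longlonglongrightarrow> u0" "b \<longlonglongrightarrow> b0" and N: "filterlim N at_top sequentially"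
    and zero: "\<And>n. soft_imbalance (N n) (Ms n) (u n) (b n) = 0"
  shows "measure M (space M) \<le> 2 * measure M {x \<in> space M. b0 \<le> u0 \<bullet> x}"
proof -
  interpret finite_measure M
    using M by (simp add: finite_topological_measure_def)
  have meas: "{x \<in> space M. b0 \<le> u0 \<bullet> x} \<in> sets M"
    by (rule hyperplane_measurable [OF M])
  let ?A = "{x \<in> space M. b0 \<le> u0 \<bullet> x}"
  let ?g = "\<lambda>x. if u0 \<bullet> x - b0 \<ge> 0 then 1 else - 1 :: real"
  have g: "?g x = 2 * indicat_real ?A x - 1" if "x \<in> space M" for x
    using that by (simp add: indicator_def)
  have A: "integrable M (indicat_real ?A)"
    using meas by (simp add: emeasure_eq_measure)
  have "(\<lambda>n. \<integral>x. ramp (real (Suc n)) (u0 \<bullet> x - b0) \<partial>M) \<longlonglongrightarrow> (\<integral>x. ?g x \<partial>M)"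
  proof (rule integral_bounded_tendsto [OF M _ ramp_bound ramp_tendsto])
    show "?g \<in> borel_measurable M"
      by (rule iffD2 [OF measurable_cong [OF g]], assumption)
        (intro borel_measurable_diff borel_measurable_times borel_measurable_const borel_measurable_indicator meas)
  qed (auto intro!: continuous_profile [OF ramp_lipschitz])
  moreover have "0 \<le> (\<integral>x. ramp (real (Suc n)) (u0 \<bullet> x - b0) \<partial>M)" for n
  proof (rule ccontr)
    assume "\<not> ?thesis"
    then have "\<forall>\<^sub>F n in sequentially. soft_imbalance (N n) (Ms n) (u n) (b n) < 0"
      by (intro soft_imbalance_limit_le [OF Ms M conv(1,2) N _ _ conv(3), where m = "real (Suc n)"]) auto
    then show False
      using zero by simp
  qed
  ultimately have "0 \<le> (\<integral>x. ?g x \<partial>M)"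
    by (intro LIMSEQ_le_const) auto
  also have "(\<integral>x. ?g x \<partial>M) = (\<integral>x. 2 * indicat_real ?A x - 1 \<partial>M)"
    using g by (rule Bochner_Integration.integral_cong [OF refl])
  also have "\<dots> = 2 * measure M ?A - measure M (space M)"
    using A meas by (simp add: Bochner_Integration.integral_diff)
  finally show ?thesis by simp
qed

text \<open>Each closed halfspace carries at least half of the mass; together they cover the carrier
  and they overlap in a null set, so both inequalities are equalities.\<close>

lemma soft_imbalance_limit_bisects:
  fixes u :: "nat \<Rightarrow> 'a::euclidean_space"
  assumes Ms: "\<And>n. finite_topological_measure (Ms n)" and M: "finite_topological_measure M"
    and conv: "weakly_converges Ms M" "u \<longlonglongrightarrow> u0" "b \<longlonglongrightarrow> b0" and N: "filterlim N at_top sequentially"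
    and zero: "\<And>n. soft_imbalance (N n) (Ms n) (u n) (b n) = 0"
    and null: "measure M {x \<in> space M. u0 \<bullet> x = b0} = 0"
  shows "measure M {x \<in> space M. u0 \<bullet> x \<le> b0} = measure M (space M) / 2"
    and "measure M {x \<in> space M. b0 \<le> u0 \<bullet> x} = measure M (space M) / 2"
proof -
  interpret finite_measure M
    using M by (simp add: finite_topological_measure_def)
  let ?G = "{x \<in> space M. b0 \<le> u0 \<bullet> x}" and ?L = "{x \<in> space M. u0 \<bullet> x \<le> b0}"
  let ?E = "{x \<in> space M. u0 \<bullet> x = b0}"
  have sets: "?G \<in> sets M" "?L \<in> sets M" "?E \<in> sets M"
    by (rule hyperplane_measurable [OF M])+
  have 1: "measure M (space M) \<le> 2 * measure M ?G"
    by (rule halfspace_measure_le [OF Ms M conv N zero])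
  have "measure M (space M) \<le> 2 * measure M {x \<in> space M. - b0 \<le> - u0 \<bullet> x}"
    by (rule halfspace_measure_le [OF Ms M conv(1) tendsto_minus [OF conv(2)] tendsto_minus [OF conv(3)] N])
       (simp add: soft_imbalance_minus zero)
  then have 2: "measure M (space M) \<le> 2 * measure M ?L"
    by simp
  have "?G \<union> ?L = space M" "?G \<inter> ?L = ?E"
    by auto
  then have "measure M ?G + measure M ?L = measure M (space M)"
    using finite_measure_Union' [OF sets(1,2)] finite_measure_Diff' [OF sets(2,1)] null
    by (simp add: Int_commute)
  with 1 2 show "measure M ?L = measure M (space M) / 2" "measure M ?G = measure M (space M) / 2"
    by linarith+
qed

section \<open>Horizontal subspaces\<close>

lemma mass_distribution_finite_topological:
  assumes "mass_distribution h M"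
  shows "finite_topological_measure M" "measure M (space M) > 0"
proof -
  have fin: "finite_measure M"
    using assms by (intro finite_measureI) (auto simp: mass_distribution_def)
  have "g \<in> borel_measurable M" if "continuous_on UNIV g" for g :: "'a \<Rightarrow> real"
  proof (rule borel_measurableI)
    fix S :: "real set" assume "open S"
    then have "open (g -` S)"
      using that by (simp add: continuous_on_open_vimage)
    then have "openin (top_of_set h) (g -` S \<inter> h)"
      by (simp add: openin_open_Int Int_commute)
    then show "g -` S \<inter> space M \<in> sets M"
      using assms by (simp add: mass_distribution_def)
  qed
  with fin show "finite_topological_measure M"
    by (simp add: finite_topological_measure_def)
  show "measure M (space M) > 0"
    using assms fin finite_measure.emeasure_eq_measure [OF fin, of h]
    by (simp add: mass_distribution_def)
qed

lemma hyperplane_of_inner: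
  fixes h :: "'a::euclidean_space set"
  assumes "subspace h" "a \<in> h" "a \<noteq> 0"
  shows "hyperplane_of h {x \<in> h. a \<bullet> x = b}"
proof -
  have eq: "{x \<in> h. a \<bullet> x = b} = h \<inter> {x. a \<bullet> x = b}"
    by auto
  have aff: "affine h"
    using assms(1) by (rule subspace_imp_affine)
  \<comment> \<open>Multiples of \<open>a\<close> at which the inner product takes the values b and
    b + 1: \<open>h\<close> meets the hyperplane without lying in it.\<close>
  have "(b / (a \<bullet> a)) *\<^sub>R a \<in> h \<inter> {x. a \<bullet> x = b}"
    using assms by (simp add: subspace_scale)
  moreover have "((b + 1) / (a \<bullet> a)) *\<^sub>R a \<in> h - {x. a \<bullet> x = b}"
    using assms by (simp add: subspace_scale)
  ultimately have "h \<inter> {x. a \<bullet> x = b} \<noteq> {}" "\<not> h \<subseteq> {x. a \<bullet> x = b}"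
    by blast+
  then have "aff_dim (h \<inter> {x. a \<bullet> x = b}) = aff_dim h - 1"
    by (simp only: aff_dim_affine_Int_hyperplane [OF aff] if_False)
  then show ?thesis
    unfolding hyperplane_of_def eq using aff by (auto simp: affine_Int affine_hyperplane)
qed

lemma mass_distribution_hyperplane_null:
  assumes M: "mass_distribution h M" and h: "subspace h" "a \<in> h" "a \<noteq> 0"
  shows "measure M {x \<in> space M. a \<bullet> x = b} = 0"
proof -
  have sp: "space M = h"
    using M by (simp add: mass_distribution_def)
  have "{x \<in> space M. a \<bullet> x = b} \<in> sets M"
    by (rule hyperplane_measurable [OF mass_distribution_finite_topological(1) [OF M]])
  moreover have "aff_dim {x \<in> space M. a \<bullet> x = b} < aff_dim h"
    using hyperplane_of_inner [OF h, of b] by (simp add: hyperplane_of_def sp)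
  ultimately have "emeasure M {x \<in> space M. a \<bullet> x = b} = 0"
    using M unfolding mass_distribution_def by blast
  then show ?thesis
    by (simp add: measure_def)
qed

section \<open>Orthonormal frames and continuity of the spanned subspace\<close>

lemma unit_vec_inner:
  assumes "i \<in> {1..CARD('d)}" "j \<in> {1..CARD('d)}"
  shows "(unit_vec i :: real ^ 'd::{finite,linorder}) \<bullet> unit_vec j = (if i = j then 1 else 0)"
proof -
  let ?l = "sorted_list_of_set (UNIV :: 'd set)"
  have "?l ! (i - 1) = ?l ! (j - 1) \<longleftrightarrow> i - 1 = j - 1"
    using assms by (intro nth_eq_iff_index_eq) auto
  also have "\<dots> \<longleftrightarrow> i = j"
    using assms by auto
  finally show ?thesis
    by (simp add: unit_vec_def inner_axis_axis)
qed

text \<open>The residual is orthogonal to the span, so Pythagoras makes the sum the nearest point.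
  The formula displays the projection as a polynomial in the frame, from which continuity into the
  Grassmannian follows.\<close>

lemma closest_point_span_orthonormal:
  fixes B :: "'a::euclidean_space set"
  assumes B: "finite B" "\<And>e f. e \<in> B \<Longrightarrow> f \<in> B \<Longrightarrow> e \<bullet> f = (if e = f then 1 else 0)"
  shows "closest_point (span B) x = (\<Sum>e\<in>B. (x \<bullet> e) *\<^sub>R e)"
proof -
  let ?p = "\<Sum>e\<in>B. (x \<bullet> e) *\<^sub>R e"
  have p: "?p \<in> span B"
    by (intro span_sum span_scale span_base)
  have "?p \<bullet> f = x \<bullet> f" if "f \<in> B" for f
  proof -
    have "?p \<bullet> f = (\<Sum>e\<in>B. (x \<bullet> e) * (if e = f then 1 else 0))"
      unfolding inner_sum_left using B that by (intro sum.cong) auto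
    also have "\<dots> = x \<bullet> f"
      using that B(1) by (simp add: if_distrib cong: if_cong)
    finally show ?thesis .
  qed
  then have orthB: "orthogonal (x - ?p) f" if "f \<in> B" for f
    using that by (simp add: orthogonal_def inner_diff_left)
  have orth: "orthogonal (x - ?p) y" if "y \<in> span B" for y
    by (rule orthogonal_to_span [OF that orthB])
  have "dist x ?p \<le> dist x z" if "z \<in> span B" for z
  proof -
    have "?p - z \<in> span B"
      using p that by (rule span_diff)
    then have "(norm (x - z))\<^sup>2 = (norm (x - ?p))\<^sup>2 + (norm (?p - z))\<^sup>2"
      using norm_add_Pythagorean [OF orth, of "?p - z"] by simp
    then have "(norm (x - ?p))\<^sup>2 \<le> (norm (x - z))\<^sup>2"
      by simp
    then show ?thesis
      by (simp add: dist_norm)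
  qed
  then show ?thesis
    by (intro closest_point_unique [symmetric] p) (auto simp: subspace_imp_convex closed_span)
qed

definition fixed_basis :: "nat \<Rightarrow> (real ^ 'd::{finite,linorder}) set" where
  "fixed_basis m = unit_vec ` {1..m}"

text \<open>The unit sphere in the orthogonal complement of e_1, ..., e_m; for m = k - 1 it is a
  sphere of dimension d - k.\<close>

definition normal_sphere :: "nat \<Rightarrow> (real ^ 'd::{finite,linorder}) set" where
  "normal_sphere m = {v. norm v = 1 \<and> (\<forall>e\<in>fixed_basis m. v \<bullet> e = 0)}"

definition horizontal_span :: "nat \<Rightarrow> real ^ 'd::{finite,linorder} \<Rightarrow> (real ^ 'd::{finite,linorder}) set" where
  "horizontal_span m v = span (insert v (fixed_basis m))"

lemma horizontal_span_minus: "horizontal_span m (- v) = horizontal_span m v"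
proof -
  have "insert (- v) B \<subseteq> span (insert v B)" for v :: "real ^ 'd::{finite,linorder}" and B
    by (auto intro: span_base span_neg)
  from this [of v "fixed_basis m"] this [of "- v" "fixed_basis m"] show ?thesis
    unfolding horizontal_span_def by (metis add.inverse_inverse span_minimal subspace_span subset_antisym)
qed

lemma subspace_horizontal_span [simp]: "subspace (horizontal_span m v)"
  by (simp add: horizontal_span_def)

lemma compact_normal_sphere: "compact (normal_sphere m)"
proof -
  have eq: "normal_sphere m = sphere 0 1 \<inter> (\<Inter>e\<in>fixed_basis m. {v. v \<bullet> e = 0})"
    by (auto simp: normal_sphere_def)
  have "closed {v. v \<bullet> e = 0}" for e :: "real ^ 'd::{finite,linorder}"
    by (intro closed_Collect_eq continuous_intros)
  then show ?thesis
    unfolding eq by (intro compact_Int_closed closed_INT ballI) auto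
qed

lemma horizontal_span_orthonormal:
  fixes v :: "real ^ 'd::{finite,linorder}"
  assumes m: "m \<le> CARD('d)" and v: "v \<in> normal_sphere m"
    and "e \<in> insert v (fixed_basis m)" "f \<in> insert v (fixed_basis m)"
  shows "e \<bullet> f = (if e = f then 1 else 0)"
proof -
  have v1: "v \<bullet> v = 1" "\<And>e. e \<in> fixed_basis m \<Longrightarrow> v \<bullet> e = 0" "\<And>e. e \<in> fixed_basis m \<Longrightarrow> e \<bullet> v = 0"
    using v by (auto simp: normal_sphere_def norm_eq_1 inner_commute)
  have fb: "e \<bullet> f = (if e = f then 1 else 0)" if "e \<in> fixed_basis m" "f \<in> fixed_basis m" for e f :: "real ^ 'd::{finite,linorder}"
  proof -
    obtain i where i: "i \<in> {1..m}" "e = unit_vec i"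
      using \<open>e \<in> fixed_basis m\<close> unfolding fixed_basis_def by blast
    obtain j where j: "j \<in> {1..m}" "f = unit_vec j"
      using \<open>f \<in> fixed_basis m\<close> unfolding fixed_basis_def by blast
    have ij: "i \<in> {1..CARD('d)}" "j \<in> {1..CARD('d)}"
      using i j m by auto
    show ?thesis
      using unit_vec_inner [OF ij] unit_vec_inner [OF ij(1,1)] i(2) j(2)
      by (cases "i = j") auto
  qed
  show ?thesis
    using assms(3,4) v1 fb by (cases "e = v"; cases "f = v") auto
qed

lemma finite_fixed_basis [simp]: "finite (fixed_basis m)"
  by (simp add: fixed_basis_def)

lemma card_fixed_basis:
  assumes "m \<le> CARD('d)"
  shows "card (fixed_basis m :: (real ^ 'd::{finite,linorder}) set) = m"
proof -
  have "inj_on (unit_vec :: nat \<Rightarrow> real ^ 'd::{finite,linorder}) {1..m}"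
  proof (rule inj_onI)
    fix i j assume ij: "i \<in> {1..m}" "j \<in> {1..m}" "(unit_vec i :: real ^ 'd::{finite,linorder}) = unit_vec j"
    then have "(unit_vec i :: real ^ 'd::{finite,linorder}) \<bullet> unit_vec j = 1"
      using unit_vec_inner [of i i, where 'd = 'd] assms by simp
    then show "i = j"
      using unit_vec_inner [of i j, where 'd = 'd] ij assms by (auto split: if_splits)
  qed
  then show ?thesis
    by (simp add: fixed_basis_def card_image)
qed

lemma dim_horizontal_span:
  fixes v :: "real ^ 'd::{finite,linorder}"
  assumes m: "m \<le> CARD('d)" and v: "v \<in> normal_sphere m"
  shows "dim (horizontal_span m v) = Suc m"
proof -
  let ?B = "insert v (fixed_basis m)"
  have "pairwise orthogonal ?B" "0 \<notin> ?B"
    unfolding pairwise_def orthogonal_def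
    using horizontal_span_orthonormal [OF assms] by (metis, metis inner_zero_left zero_neq_one)
  then have "independent ?B"
    by (rule pairwise_orthogonal_independent)
  moreover have "v \<notin> fixed_basis m"
    using v by (auto simp: normal_sphere_def norm_eq_1)
  then have "card ?B = Suc m"
    using card_fixed_basis [OF m] by simp
  ultimately show ?thesis
    unfolding horizontal_span_def dim_span by (simp add: dim_eq_card_independent)
qed

lemma horizontal_horizontal_span: "horizontal m (horizontal_span m v)"
  by (auto simp: horizontal_def horizontal_span_def fixed_basis_def intro: span_base)

lemma continuous_map_horizontal_span:
  assumes m: "m \<le> CARD('d)"
  shows "continuous_map (top_of_set (normal_sphere m)) (Hor m (Suc m))
    (horizontal_span m :: real ^ 'd::{finite,linorder} \<Rightarrow> _)"
proof -
  let ?S = "normal_sphere m :: (real ^ 'd::{finite,linorder}) set"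
  \<comment> \<open>Column j is the projection of \<open>axis j 1\<close>; the entries are quadratic
    in v.\<close>
  let ?P = "\<lambda>v. \<chi> i j. ((axis j 1 \<bullet> v) *\<^sub>R v + (\<Sum>e\<in>fixed_basis m. (axis j 1 \<bullet> e) *\<^sub>R e)) $ i"
  have P: "matrix (closest_point (horizontal_span m v)) = ?P v" if "v \<in> ?S" for v
  proof -
    have "v \<notin> fixed_basis m"
      using that by (auto simp: normal_sphere_def norm_eq_1)
    then have "closest_point (horizontal_span m v) x
        = (x \<bullet> v) *\<^sub>R v + (\<Sum>e\<in>fixed_basis m. (x \<bullet> e) *\<^sub>R e)" for x
      unfolding horizontal_span_def
      by (subst closest_point_span_orthonormal) (use horizontal_span_orthonormal [OF m that] in simp_all)
    then show ?thesis
      by (simp add: matrix_def)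
  qed
  have "continuous_on ?S ?P"
    by (intro continuous_on_vec_lambda continuous_on_component continuous_intros)
  then have "continuous_on ?S (\<lambda>v. matrix (closest_point (horizontal_span m v)))"
    using P by (subst continuous_on_cong [OF refl]) auto
  then have "continuous_map (top_of_set ?S) (grassmannian (Suc m)) (horizontal_span m)"
    unfolding grassmannian_def
    by (intro continuous_map_pullback') (auto simp: o_def dim_horizontal_span [OF m])
  then show ?thesis
    unfolding Hor_def by (auto simp: continuous_map_in_subtopology horizontal_horizontal_span)
qed

lemma continuous_mass_assignment_integral:
  fixes \<mu> :: "(real ^ 'd::{finite,linorder}) set \<Rightarrow> (real ^ 'd::{finite,linorder}) measure"
  assumes m: "m \<le> CARD('d)" and \<mu>: "mass_assignment m (Suc m) \<mu>"
  shows "continuous_on (normal_sphere m) (\<lambda>v. \<integral>x. apply_bcontfun (f :: _ \<Rightarrow>\<^sub>C real) x \<partial>\<mu> (horizontal_span m v))"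
proof -
  have 1: "continuous_map (top_of_set (normal_sphere m)) (mass_space (Suc m)) (\<mu> \<circ> horizontal_span m)"
    using \<mu> unfolding mass_assignment_def
    by (intro continuous_map_compose [OF continuous_map_horizontal_span [OF m]]) simp
  \<comment> \<open>The topology of \<open>mass_space\<close> is pulled back from a product, and
    integration of \<open>f\<close> is one of its coordinates.\<close>
  have "continuous_map (mass_space (Suc m)) euclideanreal
     ((\<lambda>F. F f) \<circ> (\<lambda>M. \<lambda>f :: (real ^ 'd::{finite,linorder}) \<Rightarrow>\<^sub>C real. \<integral>x. apply_bcontfun f x \<partial>M))"
    unfolding mass_space_def
    by (intro continuous_map_pullback continuous_map_product_projection) simp
  from continuous_map_compose [OF 1 this] show ?thesis
    by (simp add: o_def)
qed

lemma mass_assignment_weakly_converges: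
  fixes \<mu> :: "(real ^ 'd::{finite,linorder}) set \<Rightarrow> (real ^ 'd::{finite,linorder}) measure"
  assumes "m \<le> CARD('d)" "mass_assignment m (Suc m) \<mu>"
    and "\<And>n. v n \<in> normal_sphere m" "v0 \<in> normal_sphere m" "v \<longlonglongrightarrow> v0"
  shows "weakly_converges (\<lambda>n. \<mu> (horizontal_span m (v n))) (\<mu> (horizontal_span m v0))"
  unfolding weakly_converges_def
  using continuous_mass_assignment_integral [OF assms(1,2)] assms(3-5)
  by (auto simp: continuous_on_sequentially o_def)

lemma mass_assignment_mass_distribution:
  fixes \<mu> :: "(real ^ 'd::{finite,linorder}) set \<Rightarrow> (real ^ 'd::{finite,linorder}) measure"
  assumes "m \<le> CARD('d)" "mass_assignment m (Suc m) \<mu>" "v \<in> normal_sphere m"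
  shows "mass_distribution (horizontal_span m v) (\<mu> (horizontal_span m v))"
  using assms dim_horizontal_span [OF assms(1,3)] horizontal_horizontal_span [of m v]
  by (auto simp: mass_assignment_def topspace_Hor)

text \<open>At \<open>t = 0\<close> the normal is \<open>v\<close> and odd in \<open>v\<close>; at \<open>t = 1\<close> it is \<open>e\<^sub>1\<close> and even in \<open>v\<close>, while
  \<open>horizontal_span m v\<close> is always even.\<close>

definition cut_normal :: "real \<times> (real ^ 'd::{finite,linorder}) \<Rightarrow> real ^ 'd::{finite,linorder}" where
  "cut_normal = (\<lambda>(t, v). (1 - t) *\<^sub>R v + t *\<^sub>R unit_vec 1)"

lemma cut_normal:
  fixes v :: "real ^ 'd::{finite,linorder}"
  assumes "1 \<le> m" "m \<le> CARD('d)" "v \<in> normal_sphere m"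
  shows "cut_normal (t, v) \<noteq> 0" "cut_normal (t, v) \<in> horizontal_span m v"
proof -
  have e: "unit_vec 1 \<in> fixed_basis m"
    using assms(1) by (auto simp: fixed_basis_def)
  have ortho: "v \<bullet> v = 1" "v \<bullet> unit_vec 1 = 0"
    using assms(3) e by (auto simp: normal_sphere_def norm_eq_1)
  have u1: "(unit_vec 1 :: real ^ 'd::{finite,linorder}) \<bullet> unit_vec 1 = 1"
    using unit_vec_inner [of 1 1, where 'd = 'd] assms(1,2) by simp
  \<comment> \<open>The coordinates 1 - t and t along two orthonormal vectors cannot both
    vanish.\<close>
  have "cut_normal (t, v) \<bullet> v = 1 - t" "cut_normal (t, v) \<bullet> unit_vec 1 = t"
    using ortho u1 inner_commute [of v "unit_vec 1"] by (auto simp: cut_normal_def inner_add_left)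
  then show "cut_normal (t, v) \<noteq> 0"
    by (metis diff_zero inner_zero_left zero_neq_one)
  show "cut_normal (t, v) \<in> horizontal_span m v"
    using e unfolding cut_normal_def horizontal_span_def
    by (auto intro!: span_add span_scale intro: span_base)
qed

text \<open>For m < d this carries the sphere to the unit vectors spanned by e_(m+1), ..., e_d.
  Coordinates of \<open>nsphere\<close> start at 0 and basis vectors at 1, whence the index
  \<open>Suc m + i\<close>.\<close>

definition sphere_embed :: "nat \<Rightarrow> (nat \<Rightarrow> real) \<Rightarrow> real ^ 'd::{finite,linorder}" where
  "sphere_embed m y = (\<Sum>i\<le>CARD('d) - Suc m. y i *\<^sub>R unit_vec (Suc m + i))"

lemma sphere_embed_antipode: "sphere_embed m (antipode y) = - sphere_embed m y"
  by (simp add: sphere_embed_def antipode_def sum_negf)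

lemma sphere_embed_inner:
  assumes "m < CARD('d)" and j: "j \<in> {1..CARD('d)}"
  shows "(sphere_embed m y :: real ^ 'd::{finite,linorder}) \<bullet> unit_vec j = (if j \<le> m then 0 else y (j - Suc m))"
proof -
  let ?n = "CARD('d) - Suc m"
  have "(sphere_embed m y :: real ^ 'd::{finite,linorder}) \<bullet> unit_vec j
      = (\<Sum>i\<le>?n. if Suc m + i = j then y i else 0)"
    unfolding sphere_embed_def inner_sum_left inner_scaleR_left
  proof (rule sum.cong [OF refl])
    fix i assume "i \<in> {..?n}"
    then have "Suc m + i \<in> {1..CARD('d)}"
      using assms(1) by simp
    then show "y i * ((unit_vec (Suc m + i) :: real ^ 'd::{finite,linorder}) \<bullet> unit_vec j)
        = (if Suc m + i = j then y i else 0)"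
      using unit_vec_inner [of "Suc m + i" j, where 'd = 'd] j by simp
  qed
  also have "\<dots> = (if j \<le> m then 0 else y (j - Suc m))"
  proof (cases "j \<le> m")
    case False
    then have "(\<Sum>i\<le>?n. if Suc m + i = j then y i else 0) = (\<Sum>i\<le>?n. if j - Suc m = i then y i else 0)"
      by (intro sum.cong) auto
    also have "\<dots> = y (j - Suc m)"
      using diff_le_mono [of j "CARD('d)" "Suc m"] j by (simp add: sum.delta')
    finally show ?thesis
      using False by simp
  qed simp
  finally show ?thesis .
qed

lemma norm_sphere_embed:
  assumes m: "m < CARD('d)" and y: "y \<in> topspace (nsphere (CARD('d) - Suc m))"
  shows "norm (sphere_embed m y :: real ^ 'd::{finite,linorder}) = 1"
proof -
  let ?n = "CARD('d) - Suc m" and ?v = "sphere_embed m y :: real ^ 'd::{finite,linorder}"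
  have "?v \<bullet> ?v = ?v \<bullet> (\<Sum>i\<le>?n. y i *\<^sub>R unit_vec (Suc m + i))"
    by (simp only: sphere_embed_def)
  also have "\<dots> = (\<Sum>i\<le>?n. y i * (?v \<bullet> unit_vec (Suc m + i)))"
    by (simp only: inner_sum_right inner_scaleR_right)
  also have "\<dots> = (\<Sum>i\<le>?n. (y i)\<^sup>2)"
    using m by (intro sum.cong) (simp_all add: sphere_embed_inner power2_eq_square)
  also have "\<dots> = 1"
    using y by (simp add: nsphere)
  finally show ?thesis
    by (simp only: norm_eq_1)
qed

lemma sphere_embed_in_normal_sphere:
  assumes m: "m < CARD('d)" and y: "y \<in> topspace (nsphere (CARD('d) - Suc m))"
  shows "(sphere_embed m y :: real ^ 'd::{finite,linorder}) \<in> normal_sphere m"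
proof -
  have "(sphere_embed m y :: real ^ 'd::{finite,linorder}) \<bullet> unit_vec j = 0" if "j \<in> {1..m}" for j
    using sphere_embed_inner [of m j y, where 'd = 'd] that m by simp
  then show ?thesis
    using norm_sphere_embed [OF assms] unfolding normal_sphere_def fixed_basis_def by blast
qed

lemma continuous_map_sphere_embed:
  "continuous_map (nsphere n) euclidean (sphere_embed m :: _ \<Rightarrow> real ^ 'd::{finite,linorder})"
proof -
  have "continuous_map (nsphere n) euclidean (\<lambda>y. y i *\<^sub>R (c :: real ^ 'd::{finite,linorder}))" for i c
    using continuous_map_compose [OF continuous_map_nsphere_projection, of euclidean "\<lambda>s. s *\<^sub>R c" n i]
    by (simp add: o_def continuous_intros)
  then show ?thesis
    unfolding sphere_embed_def by (intro continuous_map_sum) auto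
qed

lemma continuous_map_fst_sphere_embed:
  assumes "m < CARD('d)"
  shows "continuous_map (prod_topology (top_of_set {0..1}) (nsphere (CARD('d) - Suc m)))
    (top_of_set ({0..1} \<times> normal_sphere m))
    (\<lambda>p. (fst p :: real, sphere_embed m (snd p) :: real ^ 'd::{finite,linorder}))"
proof -
  let ?X = "prod_topology (top_of_set {0..1::real}) (nsphere (CARD('d) - Suc m))"
  let ?e = "\<lambda>p. (fst p :: real, sphere_embed m (snd p) :: real ^ 'd::{finite,linorder})"
  have "continuous_map ?X euclidean (\<lambda>p. fst p)"
    using continuous_map_fst [of "top_of_set {0..1::real}" "nsphere (CARD('d) - Suc m)"]
    by (simp add: continuous_map_in_subtopology)
  moreover have "continuous_map ?X euclidean (\<lambda>p. sphere_embed m (snd p) :: real ^ 'd::{finite,linorder})"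
    using continuous_map_compose [OF continuous_map_snd continuous_map_sphere_embed]
    by (simp add: o_def)
  ultimately have "continuous_map ?X (prod_topology euclidean euclidean) ?e"
    unfolding continuous_map_paired by blast
  then show ?thesis
    using sphere_embed_in_normal_sphere [OF assms]
    by (auto simp: continuous_map_in_subtopology)
qed

section \<open>The space of candidate cuts\<close>

definition cut_space :: "nat \<Rightarrow> (real \<times> (real ^ 'd::{finite,linorder})) set" where
  "cut_space m = {0..1} \<times> normal_sphere m"

lemma compact_cut_space: "compact (cut_space m)"
  unfolding cut_space_def by (intro compact_Times compact_normal_sphere) auto

lemma cut_space_mass_distribution:
  fixes \<mu> :: "(real ^ 'd::{finite,linorder}) set \<Rightarrow> (real ^ 'd::{finite,linorder}) measure"
  assumes "m \<le> CARD('d)" "mass_assignment m (Suc m) \<mu>" "p \<in> cut_space m"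
  shows "mass_distribution (horizontal_span m (snd p)) (\<mu> (horizontal_span m (snd p)))"
  using mass_assignment_mass_distribution [OF assms(1,2), of "snd p"] assms(3)
  by (auto simp: cut_space_def)

lemma cut_space_weakly_converges:
  fixes \<mu> :: "(real ^ 'd::{finite,linorder}) set \<Rightarrow> (real ^ 'd::{finite,linorder}) measure"
  assumes "m \<le> CARD('d)" "mass_assignment m (Suc m) \<mu>"
    and p: "\<And>j. p j \<in> cut_space m" "p0 \<in> cut_space m" "p \<longlonglongrightarrow> p0"
  shows "weakly_converges (\<lambda>j. \<mu> (horizontal_span m (snd (p j)))) (\<mu> (horizontal_span m (snd p0)))"
proof (rule mass_assignment_weakly_converges [OF assms(1,2)])
  show "snd (p j) \<in> normal_sphere m" for j
    using p(1) [of j] by (auto simp: cut_space_def)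
  show "snd p0 \<in> normal_sphere m"
    using p(2) by (auto simp: cut_space_def)
  show "(\<lambda>j. snd (p j)) \<longlonglongrightarrow> snd p0"
    using p(3) by (rule tendsto_snd)
qed

lemma cut_normal_tendsto: "p \<longlonglongrightarrow> p0 \<Longrightarrow> (\<lambda>j. cut_normal (p j)) \<longlonglongrightarrow> cut_normal p0"
  unfolding cut_normal_def case_prod_beta by (intro tendsto_intros)

definition cut_median ::
    "nat \<Rightarrow> real \<Rightarrow> ((real ^ 'd::{finite,linorder}) set \<Rightarrow> (real ^ 'd::{finite,linorder}) measure)
      \<Rightarrow> real \<times> (real ^ 'd::{finite,linorder}) \<Rightarrow> real" where
  "cut_median m N \<nu> p = soft_median N (\<nu> (horizontal_span m (snd p))) (cut_normal p)"

definition cut_imbalance ::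
    "nat \<Rightarrow> real \<Rightarrow> ((real ^ 'd::{finite,linorder}) set \<Rightarrow> (real ^ 'd::{finite,linorder}) measure)
      \<Rightarrow> ((real ^ 'd::{finite,linorder}) set \<Rightarrow> (real ^ 'd::{finite,linorder}) measure)
      \<Rightarrow> real \<times> (real ^ 'd::{finite,linorder}) \<Rightarrow> real" where
  "cut_imbalance m N \<nu> \<mu> p =
    soft_imbalance N (\<mu> (horizontal_span m (snd p))) (cut_normal p) (cut_median m N \<nu> p)"

lemma continuous_on_cut_imbalance:
  fixes \<mu> \<nu> :: "(real ^ 'd::{finite,linorder}) set \<Rightarrow> (real ^ 'd::{finite,linorder}) measure"
  assumes m: "m \<le> CARD('d)" and \<nu>: "mass_assignment m (Suc m) \<nu>" and \<mu>: "mass_assignment m (Suc m) \<mu>"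
    and N: "0 < N"
  shows "continuous_on (cut_space m) (cut_imbalance m N \<nu> \<mu>)"
  unfolding continuous_on_sequentially
proof (intro allI ballI impI, elim conjE)
  fix p and p0 :: "real \<times> (real ^ 'd::{finite,linorder})"
  assume p0: "p0 \<in> cut_space m" and "\<forall>j. p j \<in> cut_space m" and p: "p \<longlonglongrightarrow> p0"
  then have pS: "p j \<in> cut_space m" for j by blast
  note M = mass_distribution_finite_topological [OF cut_space_mass_distribution [OF m \<nu>]]
    mass_distribution_finite_topological(1) [OF cut_space_mass_distribution [OF m \<mu>]]
  have "(\<lambda>j. cut_median m N \<nu> (p j)) \<longlonglongrightarrow> cut_median m N \<nu> p0"
    unfolding cut_median_def
    by (rule soft_median_tendsto [OF M(1) [OF pS] M(2) [OF pS] M(1) [OF p0] M(2) [OF p0]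
          cut_space_weakly_converges [OF m \<nu> pS p0 p] cut_normal_tendsto [OF p] N])
  then show "(cut_imbalance m N \<nu> \<mu> \<circ> p) \<longlonglongrightarrow> cut_imbalance m N \<nu> \<mu> p0"
    unfolding cut_imbalance_def o_def
    by (intro soft_imbalance_tendsto M(3) [OF pS] M(3) [OF p0] less_imp_le [OF N]
        cut_space_weakly_converges [OF m \<mu> pS p0 p] cut_normal_tendsto [OF p])
qed

lemma cut_imbalance_self:
  fixes \<nu> :: "(real ^ 'd::{finite,linorder}) set \<Rightarrow> (real ^ 'd::{finite,linorder}) measure"
  assumes "m \<le> CARD('d)" "mass_assignment m (Suc m) \<nu>" "p \<in> cut_space m" "0 < N"
  shows "cut_imbalance m N \<nu> \<nu> p = 0"
  unfolding cut_imbalance_def cut_median_def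
  by (rule soft_imbalance_median
      [OF mass_distribution_finite_topological [OF cut_space_mass_distribution [OF assms(1-3)]] assms(4)])

text \<open>Replacing v by -v keeps the subspace and reverses the normal. The median of the first
  mass changes sign with it, so the cut is the same hyperplane with its sides exchanged.\<close>

lemma cut_imbalance_odd:
  fixes \<mu> \<nu> :: "(real ^ 'd::{finite,linorder}) set \<Rightarrow> (real ^ 'd::{finite,linorder}) measure"
  assumes "m \<le> CARD('d)" "mass_assignment m (Suc m) \<nu>" "v \<in> normal_sphere m" "0 < N"
  shows "cut_imbalance m N \<nu> \<mu> (0, - v) = - cut_imbalance m N \<nu> \<mu> (0, v)"
proof -
  have "(0, v) \<in> cut_space m"
    using assms(3) by (simp add: cut_space_def)
  then have "cut_median m N \<nu> (0, - v) = - cut_median m N \<nu> (0, v)"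
    using soft_median_minus
      [OF mass_distribution_finite_topological [OF cut_space_mass_distribution [OF assms(1,2)]] assms(4)]
    by (force simp: cut_median_def horizontal_span_minus cut_normal_def)
  then show ?thesis
    using soft_imbalance_minus [of N _ v]
    by (simp add: cut_imbalance_def horizontal_span_minus cut_normal_def)
qed

lemma cut_imbalance_even: "cut_imbalance m N \<nu> \<mu> (1, - v) = cut_imbalance m N \<nu> \<mu> (1, v)"
  by (simp add: cut_imbalance_def cut_median_def horizontal_span_minus cut_normal_def)

lemma common_soft_cut:
  fixes \<mu> :: "nat \<Rightarrow> (real ^ 'd::{finite,linorder}) set \<Rightarrow> (real ^ 'd::{finite,linorder}) measure"
  assumes m: "m < CARD('d)" and \<mu>: "\<And>i. i \<in> {1..CARD('d) - Suc m + 2} \<Longrightarrow> mass_assignment m (Suc m) (\<mu> i)"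
    and N: "0 < N"
  shows "\<exists>p\<in>cut_space m. \<forall>i\<in>{1..CARD('d) - Suc m + 2}. cut_imbalance m N (\<mu> 1) (\<mu> i) p = 0"
proof -
  define n where "n = CARD('d) - Suc m"
  let ?X = "prod_topology (top_of_set {0..1::real}) (nsphere n)"
  let ?e = "\<lambda>p. (fst p :: real, sphere_embed m (snd p) :: real ^ 'd::{finite,linorder})"
  let ?g = "\<lambda>i. cut_imbalance m N (\<mu> 1) (\<mu> i)"
  have m': "m \<le> CARD('d)"
    using m by simp
  have 1: "mass_assignment m (Suc m) (\<mu> 1)"
    by (rule \<mu>) simp
  have e: "continuous_map ?X (top_of_set (cut_space m)) ?e"
    unfolding n_def cut_space_def by (rule continuous_map_fst_sphere_embed [OF m])
  have eS: "?e (t, y) \<in> cut_space m" if "t \<in> {0..1}" "y \<in> topspace (nsphere n)" for t y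
    using funcset_mem [OF continuous_map_funspace [OF e], of "(t, y)"] that by simp
  \<comment> \<open>The n + 1 functions are indexed from 0 and belong to the masses 2, ..., n + 2;
    mass 1 has determined the offset and is balanced automatically.\<close>
  have cont: "continuous_map ?X euclideanreal (\<lambda>p. ?g (i + 2) (?e p))" if "i \<le> n" for i
  proof -
    have "mass_assignment m (Suc m) (\<mu> (i + 2))"
      using that by (intro \<mu>) (auto simp: n_def)
    then have "continuous_map (top_of_set (cut_space m)) euclideanreal (?g (i + 2))"
      unfolding continuous_map_iff_continuous by (rule continuous_on_cut_imbalance [OF m' 1 _ N])
    from continuous_map_compose [OF e this] show ?thesis
      by (simp only: o_def)
  qed
  have "\<exists>t\<in>{0..1}. \<exists>y\<in>topspace (nsphere n). \<forall>i\<le>n. ?g (i + 2) (?e (t, y)) = 0"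
  proof (rule odd_even_homotopy_has_zero [OF cont])
    fix i y assume "i \<le> n" and y: "y \<in> topspace (nsphere n)"
    have v: "(sphere_embed m y :: real ^ 'd::{finite,linorder}) \<in> normal_sphere m"
      using eS [of 0 y] y by (simp add: cut_space_def)
    show "?g (i + 2) (?e (0, antipode y)) = - ?g (i + 2) (?e (0, y))"
      using cut_imbalance_odd [OF m' 1 v N] by (simp add: sphere_embed_antipode)
    show "?g (i + 2) (?e (1, antipode y)) = ?g (i + 2) (?e (1, y))"
      by (simp add: sphere_embed_antipode cut_imbalance_even)
  qed
  then obtain t y where ty: "t \<in> {0..1}" "y \<in> topspace (nsphere n)"
    and z: "\<And>i. i \<le> n \<Longrightarrow> ?g (i + 2) (?e (t, y)) = 0"
    by blast
  have S: "?e (t, y) \<in> cut_space m"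
    using ty by (rule eS)
  have "?g i (?e (t, y)) = 0" if i: "i \<in> {1..n + 2}" for i
  proof (cases "i = 1")
    case True
    then show ?thesis
      using cut_imbalance_self [OF m' 1 S N] by simp
  next
    case False
    then have "i - 2 \<le> n" "i - 2 + 2 = i"
      using i by auto
    then show ?thesis
      using z [of "i - 2"] by simp
  qed
  with S show ?thesis
    unfolding n_def by blast
qed

section \<open>Limit of the soft cuts\<close>

theorem theorem3:
  fixes \<mu> :: "nat \<Rightarrow> (real ^ 'd::{finite,linorder}) set \<Rightarrow>
      (real ^ 'd::{finite,linorder}) measure"
    and k :: nat
  assumes "2 \<le> k" and "k \<le> CARD('d)"
    and "\<And>i. i \<in> {1..CARD('d) - k + 2} \<Longrightarrow> mass_assignment (k - 1) k (\<mu> i)"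
  shows "\<exists>h. subspace h \<and> dim h = k \<and> horizontal (k - 1) h \<and>
           (\<exists>H. hyperplane_of h H \<and> (\<forall>i\<in>{1..CARD('d) - k + 2}. bisects h H (\<mu> i h)))"
proof -
  obtain m where k: "k = Suc m" and m: "1 \<le> m" "m < CARD('d)" "m \<le> CARD('d)"
    using assms(1,2) by (cases k) auto
  define n where "n = CARD('d) - Suc m"
  let ?I = "{1..n + 2}"
  have \<mu>: "mass_assignment m (Suc m) (\<mu> i)" if "i \<in> ?I" for i
    using assms(3) that by (simp add: k n_def)
  have 1: "1 \<in> ?I" by simp
  note mass = cut_space_mass_distribution [OF m(3) \<mu>]
  note M = mass_distribution_finite_topological [OF mass]
  have "\<exists>p. p \<in> cut_space m \<and> (\<forall>i\<in>?I. cut_imbalance m (real (Suc j)) (\<mu> 1) (\<mu> i) p = 0)" for j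
    using common_soft_cut [OF m(2), of \<mu> "real (Suc j)"] \<mu> unfolding n_def by auto
  then obtain p where p: "\<And>j. p j \<in> cut_space m"
      "\<And>j i. i \<in> ?I \<Longrightarrow> cut_imbalance m (real (Suc j)) (\<mu> 1) (\<mu> i) (p j) = 0"
    by metis
  \<comment> \<open>Two subsequences are taken in turn: of the parameters, by compactness, and then
    of the offsets, whose boundedness relies on the convergence of the parameters.\<close>
  obtain p0 r where p0: "p0 \<in> cut_space m" and r: "strict_mono r" "(p \<circ> r) \<longlonglongrightarrow> p0"
    using p(1) compact_cut_space unfolding compact_def by blast
  define b where "b = (\<lambda>j. cut_median m (real (Suc (r j))) (\<mu> 1) (p (r j)))"
  have N: "filterlim (\<lambda>j. real (Suc (r j))) at_top sequentially"
    using filterlim_compose [OF filterlim_compose [OF filterlim_real_sequentially filterlim_Suc] filterlim_subseq [OF r(1)]]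
    by simp
  have r': "(\<lambda>j. p (r j)) \<longlonglongrightarrow> p0"
    using r(2) by (simp add: o_def)
  have "Bseq b"
    unfolding b_def cut_median_def
    by (rule soft_median_Bseq [OF M(1) [OF 1 p(1)] M(2) [OF 1 p(1)] M(1) [OF 1 p0] M(2) [OF 1 p0]
          cut_space_weakly_converges [OF m(3) \<mu> [OF 1] p(1) p0 r'] cut_normal_tendsto [OF r'] N]) simp
  then obtain b0 s where s: "strict_mono s" "(b \<circ> s) \<longlonglongrightarrow> b0"
    using bounded_imp_convergent_subsequence [of b] by (auto simp: Bseq_eq_bounded)
  define q where "q = (\<lambda>j. p (r (s j)))"
  have q: "\<And>j. q j \<in> cut_space m" "q \<longlonglongrightarrow> p0" "(\<lambda>j. b (s j)) \<longlonglongrightarrow> b0"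
    and N': "filterlim (\<lambda>j. real (Suc (r (s j)))) at_top sequentially"
    using p(1) LIMSEQ_subseq_LIMSEQ [OF r' s(1)] s(2) filterlim_compose [OF N filterlim_subseq [OF s(1)]]
    by (auto simp: q_def o_def)
  let ?h = "horizontal_span m (snd p0)"
  let ?a = "cut_normal p0"
  have v: "snd p0 \<in> normal_sphere m"
    using p0 by (auto simp: cut_space_def)
  have a: "?a \<noteq> 0" "?a \<in> ?h"
    using cut_normal [OF m(1,3) v, of "fst p0"] by simp_all
  have "bisects ?h {x \<in> ?h. ?a \<bullet> x = b0} (\<mu> i ?h)" if i: "i \<in> ?I" for i
  proof -
    have sp: "space (\<mu> i ?h) = ?h"
      using mass [OF i p0] by (simp add: mass_distribution_def)
    \<comment> \<open>The offsets \<open>b (s j)\<close> do not depend on \<open>i\<close>, so all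
      masses share the limiting hyperplane.\<close>
    have z: "soft_imbalance (real (Suc (r (s j)))) (\<mu> i (horizontal_span m (snd (q j)))) (cut_normal (q j)) (b (s j)) = 0" for j
      using p(2) [OF i, of "r (s j)"] by (simp add: cut_imbalance_def b_def q_def)
    note bis = soft_imbalance_limit_bisects [OF M(1) [OF i q(1)] M(1) [OF i p0]
        cut_space_weakly_converges [OF m(3) \<mu> [OF i] q(1) p0 q(2)] cut_normal_tendsto [OF q(2)] q(3) N' z
        mass_distribution_hyperplane_null [OF mass [OF i p0] subspace_horizontal_span a(2,1)]]
    have "measure (\<mu> i ?h) {x \<in> ?h. ?a \<bullet> x \<le> b0} = measure (\<mu> i ?h) ?h / 2"
      "measure (\<mu> i ?h) {x \<in> ?h. b0 \<le> ?a \<bullet> x} = measure (\<mu> i ?h) ?h / 2"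
      using bis unfolding sp by blast+
    then show ?thesis
      unfolding bisects_def using a by auto
  qed
  moreover have "hyperplane_of ?h {x \<in> ?h. ?a \<bullet> x = b0}"
    by (rule hyperplane_of_inner [OF subspace_horizontal_span a(2,1)])
  ultimately have "\<exists>H. hyperplane_of ?h H \<and> (\<forall>i\<in>{1..CARD('d) - k + 2}. bisects ?h H (\<mu> i ?h))"
    by (auto simp: k n_def)
  moreover have "dim ?h = k" "horizontal (k - 1) ?h"
    using dim_horizontal_span [OF m(3) v] horizontal_horizontal_span by (simp_all add: k)
  ultimately show ?thesis
    using subspace_horizontal_span by blast
qed

end
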